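(* Let $N\ge3$, let $(x,x_1,x_{12},x_2)$ be a planar quadrilateral in $\mathbb{RP}^N$, and let $f^1,f^2\in\mathcal{F}_{o,\pi}(N)$ be projective reflections with $f^i(x)=x_i$, $i=1,2$. Then there exist unique projective reflections $f^1_2,f^2_1\in\mathcal{F}_{o,\pi}(N)$ which are determined by the conditions $$f^i_j(x_j)=x_{12}\ \text{ for } \{i,j\}=\{1,2\}, \qquad\text{and}\qquad (f^2_1\circ f^1)(l)=(f^1_2\circ f^2)(l)\ \text{ for all lines } l\subset\mathbb{RP}^N \text{ with } x\in l.$$ Further, let $x:\mathbb{Z}^m\to\mathbb{RP}^N$, $N\ge3$, be a generic Q-net. Then the induced propagation $$\tau:\mathbb{Z}^m\times\mathcal{F}_{o,\pi}(N)\times\mathcal{F}_{o,\pi}(N)\to\mathcal{F}_{o,\pi}(N)\times\mathcal{F}_{o,\pi}(N),\qquad (f^i,f^j)\mapsto(f^i_j,f^j_i)$$ of projective reflections (applying the first part to the elementary quadrilaterals $(x,x_i,x_{ij},x_j)$ of the Q-net) is $m$D consistent; that is, admissible Cauchy data $f^i|_{\mathcal{B}^i}$, $i=1,\dots,m$, i.e. reflections in $\mathcal{F}_{o,\pi}(N)$ associated with the edges of the coordinate axes and mapping adjacent vertices of $x$ onto each other, determines all remaining projective reflections (on all edges of $\mathbb{Z}^m$) uniquely.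
   Context: Projective reflections: disjoint subspaces $U,V\subset\mathbb{RP}^N$ with $U\vee V=\mathbb{RP}^N$ (join) induce a projective map $f:\mathbb{RP}^N\to\mathbb{RP}^N$ fixing all points of $U\cup V$; any other point $y$ lies on a unique line meeting $U$ in a point $p$ and $V$ in a point $q$, and $f(y)$ is the point of this line with cross-ratio $\operatorname{cr}(y,p,f(y),q)=-1$. It is an involution. $\mathcal{F}_{o,\pi}(N)$ denotes the set of projective reflections of $\mathbb{RP}^N$ induced by a point $o$ and a hyperplane $\pi\not\ni o$. A reflection acts on lines by taking images. A Q-net is a map $x:\mathbb{Z}^m\to\mathbb{RP}^N$ such that all elementary quadrilaterals $(x,x_i,x_{ij},x_j)$ are planar. Lower indices denote shifts: $x_i(z)=x(z+e_i)$, $f^i_j(z)=f^i(z+e_j)$. The value $f^i(z)$ is the reflection associated with the edge $(z,z+e_i)$ and maps $x(z)$ to $x(z+e_i)$. $\mathcal{B}^i=\operatorname{span}_{\mathbb{Z}}(e_i)$ is the $i$-th coordinate axis of $\mathbb{Z}^m$. $m$D consistency means that the a priori overdetermined propagation from the coordinate axes to $\mathbb{Z}^m$ by this rule on elementary quadrilaterals is well defined. As throughout the paper, data (quadrilaterals and reflections) are assumed generic, so that all joins and intersections that occur have their expected dimensions; in particular planar quadrilaterals are non-degenerate. *)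

theory Defs
  imports "HOL-Analysis.Analysis"
begin

section \<open>Projective space\<close>

text \<open>The points of the real projective space of dimension N are the one-dimensional linear
  subspaces of a real vector space \<open>'a\<close> with \<open>DIM('a) = N + 1\<close>.\<close>

typedef (overloaded) ('a::euclidean_space) pspace = "{L :: 'a set. subspace L \<and> dim L = 1}"
  morphisms vline pspace_of
proof -
  obtain b :: 'a where "b \<in> Basis" using nonempty_Basis by blast
  hence "dim (span {b}) = 1" by (auto simp: dim_insert)
  thus ?thesis by (intro exI[of _ "span {b}"]) auto
qed

definition points_in :: "'a::euclidean_space set \<Rightarrow> 'a pspace set" where
  "points_in W = {p. vline p \<subseteq> W}"

definition is_flat :: "nat \<Rightarrow> 'a::euclidean_space pspace set \<Rightarrow> bool" where
  "is_flat k S \<longleftrightarrow> (\<exists>W. subspace W \<and> dim W = k + 1 \<and> S = points_in W)"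

definition is_line :: "'a::euclidean_space pspace set \<Rightarrow> bool" where
  "is_line S \<longleftrightarrow> is_flat 1 S"

definition is_plane :: "'a::euclidean_space pspace set \<Rightarrow> bool" where
  "is_plane S \<longleftrightarrow> is_flat 2 S"

definition is_hyperplane :: "'a::euclidean_space pspace set \<Rightarrow> bool" where
  "is_hyperplane S \<longleftrightarrow> (\<exists>k. k + 2 = DIM('a) \<and> is_flat k S)"

definition join :: "'a::euclidean_space pspace set \<Rightarrow> 'a pspace set" where
  "join S = points_in (span (\<Union>p\<in>S. vline p))"

definition on_line :: "'a::euclidean_space pspace set \<Rightarrow> bool" where
  "on_line S \<longleftrightarrow> (\<exists>l. is_line l \<and> S \<subseteq> l)"

definition on_plane :: "'a::euclidean_space pspace set \<Rightarrow> bool" where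
  "on_plane S \<longleftrightarrow> (\<exists>E. is_plane E \<and> S \<subseteq> E)"

text \<open>Cross-ratio of four collinear points, with the convention
  \<open>cr(a,b,c,d) = (a - b)(c - d) / ((b - c)(d - a))\<close> for affine coordinates on the line
  (so the value -1 means that the pairs a, c and b, d separate each other harmonically), written in
  homogeneous coordinates with respect to a basis u, v of the plane representing the line.
  The value does not depend on u, v nor on the chosen coordinate vectors.\<close>

definition cross_ratio ::
  "'a::euclidean_space pspace \<Rightarrow> 'a pspace \<Rightarrow> 'a pspace \<Rightarrow> 'a pspace \<Rightarrow> real" where
  "cross_ratio a b c d = (THE r. \<exists>u v a1 a2 b1 b2 c1 c2 d1 d2.
     u \<noteq> v \<and> independent {u, v} \<and>
     vline a = span {a1 *\<^sub>R u + a2 *\<^sub>R v} \<and> vline b = span {b1 *\<^sub>R u + b2 *\<^sub>R v} \<and>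
     vline c = span {c1 *\<^sub>R u + c2 *\<^sub>R v} \<and> vline d = span {d1 *\<^sub>R u + d2 *\<^sub>R v} \<and>
     r = ((a1 * b2 - a2 * b1) * (c1 * d2 - c2 * d1)) /
         ((b1 * c2 - b2 * c1) * (d1 * a2 - d2 * a1)))"

section \<open>Projective reflections\<close>

text \<open>Meaningful only if U and V are disjoint projective subspaces whose join is the whole space.\<close>

definition proj_reflection ::
  "'a::euclidean_space pspace set \<Rightarrow> 'a pspace set \<Rightarrow> 'a pspace \<Rightarrow> 'a pspace" where
  "proj_reflection U V y =
     (if y \<in> U \<union> V then y
      else (THE z. \<exists>p\<in>U. \<exists>q\<in>V. y \<in> join {p, q} \<and> z \<in> join {p, q} \<and>
                     cross_ratio y p z q = -1))"

definition F_opi :: "('a::euclidean_space pspace \<Rightarrow> 'a pspace) set" where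
  "F_opi = {proj_reflection {p} H | p H. is_hyperplane H \<and> p \<notin> H}"

section \<open>Propagation across a planar quadrilateral\<close>

definition nondegenerate_quad ::
  "'a::euclidean_space pspace \<Rightarrow> 'a pspace \<Rightarrow> 'a pspace \<Rightarrow> 'a pspace \<Rightarrow> bool" where
  "nondegenerate_quad a b c d \<longleftrightarrow>
     \<not> on_line {a, b, c} \<and> \<not> on_line {a, b, d} \<and> \<not> on_line {a, c, d} \<and> \<not> on_line {b, c, d}"

text \<open>Genericity of two reflections f1, f2 at the vertex x of a quadrilateral (x, x1, x12, x2) with
  f1 x = x1 and f2 x = x2: the lines f1(x1 \<open>\<or>\<close> x12) and f2(x2 \<open>\<or>\<close> x12), which both
  contain x, are distinct. This is forced as soon as the propagation exists: then the common
  bijection of pencils \<open>h2 \<circ> f1 = h1 \<circ> f2\<close> sends them to the distinct lines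
  x1 \<open>\<or>\<close> x12 and x2 \<open>\<or>\<close> x12.\<close>

definition generic_reflections ::
  "'a::euclidean_space pspace \<Rightarrow> 'a pspace \<Rightarrow>
   ('a pspace \<Rightarrow> 'a pspace) \<Rightarrow> ('a pspace \<Rightarrow> 'a pspace) \<Rightarrow> bool" where
  "generic_reflections x x12 f1 f2 \<longleftrightarrow> \<not> on_line {x, f1 x12, f2 x12}"

text \<open>Graph of the propagation map: h1 and h2 are the shifted reflections on the edges
  (x2, x12) and (x1, x12), opposite to the edges of f1 and f2, respectively.\<close>

definition propagates ::
  "'a::euclidean_space pspace \<Rightarrow> 'a pspace \<Rightarrow> 'a pspace \<Rightarrow> 'a pspace \<Rightarrow>
   ('a pspace \<Rightarrow> 'a pspace) \<Rightarrow> ('a pspace \<Rightarrow> 'a pspace) \<Rightarrow>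
   ('a pspace \<Rightarrow> 'a pspace) \<Rightarrow> ('a pspace \<Rightarrow> 'a pspace) \<Rightarrow> bool" where
  "propagates x x1 x12 x2 f1 f2 h1 h2 \<longleftrightarrow>
     h1 \<in> F_opi \<and> h2 \<in> F_opi \<and> h1 x2 = x12 \<and> h2 x1 = x12 \<and>
     (\<forall>l. is_line l \<and> x \<in> l \<longrightarrow> (h2 \<circ> f1) ` l = (h1 \<circ> f2) ` l)"

section \<open>Q-nets and Cauchy data\<close>

abbreviation unit_step :: "'m::finite \<Rightarrow> int ^ 'm" where
  "unit_step i \<equiv> axis i 1"

definition coordinate_axis :: "'m::finite \<Rightarrow> (int ^ 'm) set" where
  "coordinate_axis i = range (axis i)"

definition Q_net :: "(int ^ 'm::finite \<Rightarrow> 'a::euclidean_space pspace) \<Rightarrow> bool" where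
  "Q_net x \<longleftrightarrow> (\<forall>z i j. i \<noteq> j \<longrightarrow>
     on_plane {x z, x (z + unit_step i), x (z + unit_step i + unit_step j), x (z + unit_step j)})"

text \<open>Genericity: elementary quadrilaterals are non-degenerate, and elementary cubes span a
  three-dimensional space (given non-degenerate planar faces, it suffices to say so for one vertex
  of the cube and its three neighbours).\<close>

definition generic_Q_net :: "(int ^ 'm::finite \<Rightarrow> 'a::euclidean_space pspace) \<Rightarrow> bool" where
  "generic_Q_net x \<longleftrightarrow> Q_net x \<and>
     (\<forall>z i j. i \<noteq> j \<longrightarrow>
        nondegenerate_quad (x z) (x (z + unit_step i))
          (x (z + unit_step i + unit_step j)) (x (z + unit_step j))) \<and>
     (\<forall>z i j k. i \<noteq> j \<and> i \<noteq> k \<and> j \<noteq> k \<longrightarrow>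
        \<not> on_plane {x z, x (z + unit_step i), x (z + unit_step j), x (z + unit_step k)})"

definition cauchy_data ::
  "(int ^ 'm::finite \<Rightarrow> 'a::euclidean_space pspace) \<Rightarrow>
   ('m \<Rightarrow> int ^ 'm \<Rightarrow> 'a pspace \<Rightarrow> 'a pspace) \<Rightarrow> bool" where
  "cauchy_data x g \<longleftrightarrow> (\<forall>i. \<forall>z\<in>coordinate_axis i.
     g i z \<in> F_opi \<and> g i z (x z) = x (z + unit_step i))"

text \<open>The elementary quadrilateral of lattice points (z, z1, z12, z2), seen from any of its four
  corners z. Since the coordinate axes extend in both directions, propagation also proceeds in
  negative directions.\<close>

definition lattice_quad ::
  "int ^ 'm::finite \<Rightarrow> int ^ 'm \<Rightarrow> int ^ 'm \<Rightarrow> int ^ 'm \<Rightarrow> bool" where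
  "lattice_quad z z1 z12 z2 \<longleftrightarrow>
     (\<exists>i j s t. i \<noteq> j \<and> \<bar>s\<bar> = 1 \<and> \<bar>t\<bar> = 1 \<and>
        z1 = z + axis i s \<and> z2 = z + axis j t \<and> z12 = z + axis i s + axis j t)"

text \<open>\<open>reached x g z w f\<close>: some route of propagation steps starting from the Cauchy data g
  assigns the reflection f to the edge between z and w. A priori, different routes may assign
  different reflections to the same edge. Reflections are involutions, so edges carry no
  orientation. The second output of a propagation step arises from \<open>step\<close> by
  exchanging the roles of the two edges.\<close>

inductive reached ::
  "(int ^ 'm::finite \<Rightarrow> 'a::euclidean_space pspace) \<Rightarrow>
   ('m \<Rightarrow> int ^ 'm \<Rightarrow> 'a pspace \<Rightarrow> 'a pspace) \<Rightarrow>
   int ^ 'm \<Rightarrow> int ^ 'm \<Rightarrow> ('a pspace \<Rightarrow> 'a pspace) \<Rightarrow> bool"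
  for x g where
  initial: "z \<in> coordinate_axis i \<Longrightarrow> reached x g z (z + unit_step i) (g i z)"
| reverse: "reached x g z w f \<Longrightarrow> reached x g w z f"
| step: "lattice_quad z z1 z12 z2 \<Longrightarrow> reached x g z z1 f1 \<Longrightarrow> reached x g z z2 f2 \<Longrightarrow>
         propagates (x z) (x z1) (x z12) (x z2) f1 f2 h1 h2 \<Longrightarrow> reached x g z2 z12 h1"

text \<open>Genericity of Cauchy data: whenever two reflections meet in a propagation step, they are in
  general position with respect to the quadrilateral.\<close>

definition generic_cauchy_data ::
  "(int ^ 'm::finite \<Rightarrow> 'a::euclidean_space pspace) \<Rightarrow>
   ('m \<Rightarrow> int ^ 'm \<Rightarrow> 'a pspace \<Rightarrow> 'a pspace) \<Rightarrow> bool" where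
  "generic_cauchy_data x g \<longleftrightarrow> cauchy_data x g \<and>
     (\<forall>z z1 z12 z2 f1 f2. lattice_quad z z1 z12 z2 \<and> reached x g z z1 f1 \<and> reached x g z z2 f2
        \<longrightarrow> generic_reflections (x z) (x z12) f1 f2)"

text \<open>A family f assigns the reflection \<open>f i z\<close> to the edge (z, z + e_i).\<close>

definition propagated_family ::
  "(int ^ 'm::finite \<Rightarrow> 'a::euclidean_space pspace) \<Rightarrow>
   ('m \<Rightarrow> int ^ 'm \<Rightarrow> 'a pspace \<Rightarrow> 'a pspace) \<Rightarrow> bool" where
  "propagated_family x f \<longleftrightarrow>
     (\<forall>z i. f i z \<in> F_opi \<and> f i z (x z) = x (z + unit_step i)) \<and>
     (\<forall>z i j. i \<noteq> j \<longrightarrow>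
        propagates (x z) (x (z + unit_step i)) (x (z + unit_step i + unit_step j))
          (x (z + unit_step j)) (f i z) (f j z) (f i (z + unit_step j)) (f j (z + unit_step i)))"

definition mD_consistent :: "(int ^ 'm::finite \<Rightarrow> 'a::euclidean_space pspace) \<Rightarrow> bool" where
  "mD_consistent x \<longleftrightarrow> (\<forall>g. generic_cauchy_data x g \<longrightarrow>
     (\<exists>!f. propagated_family x f \<and> (\<forall>i. \<forall>z\<in>coordinate_axis i. f i z = g i z)))"

end

theory Submission
  imports Defs
begin

text \<open>Let \<open>V\<close> be the real vector space whose lines are the points. A reflection with centre
  \<open>c\<close> has a canonical linear lift, the involution that maps \<open>v\<close> to
  \<open>v - n(v) c\<close>, where the functional \<open>n\<close> vanishes on the fixed hyperplane and
  \<open>n(c) = 2\<close>. A reflection that maps \<open>x\<close> to a different point \<open>y\<close> has its centre on the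
  line joining them, hence its lift is the identity modulo \<open>span {x, y}\<close>.

  On lines through \<open>x\<close> such a map acts like the induced linear map of quotients
  \<open>V/x \<rightarrow> V/y\<close>. So for lifts \<open>A1, A2, B1, B2\<close> on the four sides of a
  quadrilateral, the pencil condition says that \<open>B2 A1\<close> and \<open>B1 A2\<close> induce
  proportional maps \<open>V/x \<rightarrow> V/x12\<close>. Both products are the identity modulo the
  three-dimensional space of the quadrilateral, and as \<open>dim V = N + 1 \<ge> 4\<close> some vector
  lies outside it. Therefore the factor of proportionality is 1, and the pencil condition becomes
  the linear congruence \<open>B2 (A1 v) = B1 (A2 v)\<close> modulo \<open>x12\<close>, for all \<open>v\<close>
  (lemma \<open>propagates_iff\<close>).

  Modulo \<open>x12\<close> an unknown lift on the side from \<open>x1\<close> to \<open>x12\<close> has the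
  form \<open>v - \<psi>(v) x1\<close>. Independence of \<open>x1, x2, x12\<close> makes the solution of the
  congruence unique, and comparing coefficients produces the candidates for the two functionals
  \<open>\<psi>\<close>. A candidate belongs to a reflection as soon as \<open>\<psi>(x12) \<noteq> 0\<close>;
  this is what genericity of the two given reflections ensures
  (lemmas \<open>congruence_determines_reflection\<close> and \<open>congruence_solvable\<close>).

  For a cube, consider the edge from \<open>x23\<close> to \<open>x123\<close>. An invertible map
  \<open>V/x23 \<rightarrow> V/x123\<close> comes from a reflection if it is the identity modulo
  \<open>span {x23, x123}\<close>. The path \<open>x23, x2, x12, x123\<close> around one face at this edge gives
  a map that is the identity modulo the plane of that face; the path \<open>x23, x3, x13, x123\<close>
  does the same for the other face. Propagation on the remaining faces shows that the two maps
  agree, so the common map is the identity modulo the intersection of the two planes, which is the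
  edge line (lemma \<open>cube_closes\<close>). The reflection on this edge therefore exists, and all
  faces of the cube are compatible.

  The propagation relation has the symmetries of the quadrilateral. This allows orienting every
  quadrilateral of the lattice away from the origin and filling the edges by induction on the
  distance from the origin. An edge may be reached across several quadrilaterals; any two of these
  are faces of one cube, where the assigned reflections agree
  (lemma \<open>outward_unique\<close>). Conversely, the same orientation shows that a propagated
  family is determined by its values on the axes.\<close>

section \<open>Points and homogeneous coordinates\<close>

definition pt :: "'a::euclidean_space \<Rightarrow> 'a pspace" where
  "pt v = pspace_of (span {v})"

text \<open>A point again whenever \<open>A\<close> is linear and does not annihilate the line \<open>p\<close>.\<close>

definition pmap :: "('a::euclidean_space \<Rightarrow> 'a) \<Rightarrow> 'a pspace \<Rightarrow> 'a pspace" where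
  "pmap A p = pspace_of (A ` vline p)"

lemma vline_pt: "v \<noteq> 0 \<Longrightarrow> vline (pt v) = span {v}"
  unfolding pt_def by (subst pspace_of_inverse) (auto simp: dim_insert)

lemma pt_cases:
  obtains v where "v \<noteq> 0" "p = pt v"
proof -
  have s: "subspace (vline p)" "dim (vline p) = 1" using vline[of p] by auto
  obtain B where B: "B \<subseteq> vline p" "independent B" "vline p \<subseteq> span B" "card B = dim (vline p)"
    using basis_exists by blast
  obtain v where v: "B = {v}" using B(4) s(2) card_1_singletonE by metis
  have "v \<noteq> 0" using B(2) v dependent_zero by blast
  moreover have "vline p = span {v}" using B v s by (metis span_subspace)
  hence "p = pt v" unfolding pt_def by (metis vline_inverse)
  ultimately show ?thesis using that by blast
qed

lemma pmap_pt: "linear A \<Longrightarrow> v \<noteq> 0 \<Longrightarrow> pmap A (pt v) = pt (A v)"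
  unfolding pmap_def vline_pt pt_def[of "A v"]
  using linear_span_image[of A "{v}"] by (simp add: vline_pt)

lemma span_singleton_eq:
  fixes v w :: "'a::real_vector"
  assumes "w \<in> span {v}" "w \<noteq> 0"
  shows "span {w} = span {v}"
proof -
  obtain k where k: "w = k *\<^sub>R v" using assms(1) by (auto simp: span_singleton)
  hence "k \<noteq> 0" using assms(2) by auto
  hence "v = (1/k) *\<^sub>R w" using k by simp
  hence "v \<in> span {w}" by (metis span_base span_scale singletonI)
  thus ?thesis using assms(1) by (intro subset_antisym span_minimal) auto
qed

lemma pt_eq_iff: "v \<noteq> 0 \<Longrightarrow> w \<noteq> 0 \<Longrightarrow> pt v = pt w \<longleftrightarrow> w \<in> span {v}"
proof
  assume nz: "v \<noteq> 0" "w \<noteq> 0" and "pt v = pt w"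
  hence "span {v} = span {w}" by (metis vline_pt)
  thus "w \<in> span {v}" by (simp add: span_base)
next
  assume "v \<noteq> 0" "w \<noteq> 0" "w \<in> span {v}"
  thus "pt v = pt w" unfolding pt_def by (simp add: span_singleton_eq)
qed

lemma pt_in_points_in: "v \<noteq> 0 \<Longrightarrow> subspace W \<Longrightarrow> pt v \<in> points_in W \<longleftrightarrow> v \<in> W"
  unfolding points_in_def
  using span_minimal[of "{v}" W] span_base[of v "{v}"] by (auto simp: vline_pt)

lemma dim_extension:
  fixes W :: "'a::euclidean_space set"
  assumes "subspace W" "dim W \<le> n" "n \<le> DIM('a)"
  shows "\<exists>W'. subspace W' \<and> W \<subseteq> W' \<and> dim W' = n"
  using assms
proof (induction "n - dim W" arbitrary: W)
  case 0
  thus ?case by (intro exI[of _ W]) auto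
next
  case (Suc k)
  hence "dim W \<noteq> DIM('a)" by linarith
  hence "W \<noteq> UNIV" by auto
  then obtain v where v: "v \<notin> W" by auto
  let ?W = "span (insert v W)"
  have d: "dim ?W = dim W + 1"
    using v Suc.prems(1) by (simp add: dim_insert span_eq_iff[THEN iffD2])
  have "k = n - dim ?W" "dim ?W \<le> n" using d Suc.hyps(2) by auto
  then obtain W' where "subspace W' \<and> ?W \<subseteq> W' \<and> dim W' = n"
    using Suc.hyps(1)[of ?W] Suc.prems(3) by auto
  moreover have "W \<subseteq> ?W" by (meson span_superset subset_insertI subset_trans)
  ultimately show ?case by blast
qed

lemma on_line_I: "subspace W \<Longrightarrow> dim W = 2 \<Longrightarrow> S \<subseteq> points_in W \<Longrightarrow> on_line S"
  unfolding on_line_def is_line_def is_flat_def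
  by (rule exI[of _ "points_in W"], rule conjI, rule exI[of _ W]) auto

lemma on_line_pt:
  fixes A B C :: "'a::euclidean_space"
  assumes "A \<noteq> 0" "B \<noteq> 0" "C \<noteq> 0" "C \<in> span {A, B}" "DIM('a) \<ge> 2"
  shows "on_line {pt A, pt B, pt C}"
proof -
  have "dim (span {A,B}) \<le> card {A,B}" by (simp add: dim_le_card')
  also have "\<dots> \<le> 2" by (simp add: card_insert_if)
  finally obtain W where W: "subspace W" "span {A,B} \<subseteq> W" "dim W = 2"
    using dim_extension[of "span {A,B}" 2] assms(5) by auto
  have "A \<in> W" "B \<in> W" "C \<in> W" using W assms(4) by (auto intro: span_base)
  thus ?thesis using W(1,3) assms(1-3) by (intro on_line_I[of W]) (auto simp: pt_in_points_in)
qed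

lemma on_plane_I: "subspace W \<Longrightarrow> dim W = 3 \<Longrightarrow> S \<subseteq> points_in W \<Longrightarrow> on_plane S"
  unfolding on_plane_def is_plane_def is_flat_def
  by (rule exI[of _ "points_in W"], rule conjI, rule exI[of _ W]) auto

lemma on_plane_pt:
  fixes A B C D :: "'a::euclidean_space"
  assumes "A \<noteq> 0" "B \<noteq> 0" "C \<noteq> 0" "D \<noteq> 0" "D \<in> span {A, B, C}" "DIM('a) \<ge> 3"
  shows "on_plane {pt A, pt B, pt C, pt D}"
proof -
  have "dim (span {A,B,C}) \<le> card {A,B,C}" by (simp add: dim_le_card')
  also have "\<dots> \<le> 3" by (simp add: card_insert_if)
  finally obtain W where W: "subspace W" "span {A,B,C} \<subseteq> W" "dim W = 3"
    using dim_extension[of "span {A,B,C}" 3] assms(6) by auto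
  have "A \<in> W" "B \<in> W" "C \<in> W" "D \<in> W" using W assms(5) by (auto intro: span_base)
  thus ?thesis using W(1,3) assms(1-4) by (intro on_plane_I[of W]) (auto simp: pt_in_points_in)
qed

lemma on_plane_imp_span:
  fixes A B C D :: "'a::euclidean_space"
  assumes nz: "A \<noteq> 0" "B \<noteq> 0" "C \<noteq> 0" "D \<noteq> 0" and "DIM('a) \<ge> 2"
    and pl: "on_plane {pt A, pt B, pt C, pt D}" and nl: "\<not> on_line {pt A, pt B, pt C}"
  shows "D \<in> span {A, B, C}"
proof -
  obtain W where W: "subspace W" "dim W = 3" "{pt A, pt B, pt C, pt D} \<subseteq> points_in W"
    using pl unfolding on_plane_def is_plane_def is_flat_def by auto
  hence m: "A \<in> W" "B \<in> W" "C \<in> W" "D \<in> W" using nz by (auto simp: pt_in_points_in)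
  have c: "C \<notin> span {A, B}" using on_line_pt nz assms(5) nl by blast
  have b: "B \<notin> span {A}"
  proof
    assume "B \<in> span {A}"
    hence "B \<in> span {A, C}" by (meson span_mono insert_subset subset_iff empty_subsetI insertCI)
    hence "on_line {pt A, pt C, pt B}" using on_line_pt nz assms(5) by blast
    thus False using nl by (simp add: insert_commute)
  qed
  have "{B, A} = {A, B}" by auto
  hence "C \<notin> span {B, A}" using c by simp
  hence "dim {C, B, A} = 3" using b nz by (simp add: dim_insert)
  moreover have "{C, B, A} = {A, B, C}" by auto
  ultimately have "dim (span {A,B,C}) = dim W" using W by simp
  moreover have "span {A,B,C} \<subseteq> W" using m W by (intro span_minimal) auto
  ultimately have "span {A,B,C} = W" using W by (intro subspace_dim_equal) auto
  thus ?thesis using m by simp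
qed

lemma dual_vector:
  fixes y :: "'a::euclidean_space"
  assumes "y \<notin> span S"
  obtains e where "\<And>x. x \<in> span S \<Longrightarrow> e \<bullet> x = 0" "e \<bullet> y = 1"
proof -
  obtain u z where u: "u \<in> span S" "\<And>w. w \<in> span S \<Longrightarrow> orthogonal z w" "y = u + z"
    using orthogonal_subspace_decomp_exists[of S y] by blast
  have z: "z \<noteq> 0" using u assms by auto
  have "z \<bullet> y = z \<bullet> z" using u by (simp add: orthogonal_def inner_add_right)
  hence "((1 / (z \<bullet> z)) *\<^sub>R z) \<bullet> y = 1" using z by simp
  moreover have "((1 / (z \<bullet> z)) *\<^sub>R z) \<bullet> x = 0" if "x \<in> span S" for x
    using u(2)[OF that] by (simp add: orthogonal_def)
  ultimately show ?thesis using that by blast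
qed

section \<open>Reflections as linear involutions\<close>

text \<open>For \<open>n \<bullet> c = 2\<close> this is the linear involution that negates \<open>c\<close> and fixes
  the hyperplane orthogonal to \<open>n\<close>. The inner product serves only to write a linear
  functional as a vector.\<close>

definition refl_map :: "'a::real_inner \<Rightarrow> 'a \<Rightarrow> 'a \<Rightarrow> 'a" where
  "refl_map n c v = v - (n \<bullet> v) *\<^sub>R c"

lemma linear_refl_map: "linear (refl_map n c)"
  unfolding refl_map_def
  by (rule linearI) (simp_all add: inner_add_right scaleR_left_distrib scaleR_diff_right)

lemma refl_map_involution: "n \<bullet> c = 2 \<Longrightarrow> refl_map n c (refl_map n c v) = v"
  by (simp add: refl_map_def inner_diff_right scaleR_left_diff_distrib)

text \<open>Passing to another basis multiplies all four brackets in the definition by its determinant, and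
  rescaling a coordinate vector changes numerator and denominator by the same factor, so the
  definite description may be evaluated in the basis given by the second and fourth point. The
  equation also holds if \<open>\<alpha> \<delta> = 0\<close>, where both sides are quotients by zero.\<close>

lemma cross_ratio_coordinates:
  fixes U V :: "'a::euclidean_space"
  assumes "U \<noteq> V" "independent {U, V}"
    and a: "vline a = span {\<alpha> *\<^sub>R U + \<beta> *\<^sub>R V}" and b: "vline b = span {U}"
    and c: "vline c = span {\<gamma> *\<^sub>R U + \<delta> *\<^sub>R V}" and d: "vline d = span {V}"
  shows "cross_ratio a b c d = (\<beta> * \<gamma>) / (\<alpha> * \<delta>)"
  unfolding cross_ratio_def
proof (rule the_equality)
  show "\<exists>u v a1 a2 b1 b2 c1 c2 d1 d2.
     u \<noteq> v \<and> independent {u, v} \<and>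
     vline a = span {a1 *\<^sub>R u + a2 *\<^sub>R v} \<and> vline b = span {b1 *\<^sub>R u + b2 *\<^sub>R v} \<and>
     vline c = span {c1 *\<^sub>R u + c2 *\<^sub>R v} \<and> vline d = span {d1 *\<^sub>R u + d2 *\<^sub>R v} \<and>
     (\<beta> * \<gamma>) / (\<alpha> * \<delta>) = ((a1 * b2 - a2 * b1) * (c1 * d2 - c2 * d1)) /
         ((b1 * c2 - b2 * c1) * (d1 * a2 - d2 * a1))"
  proof (rule exI[of _ U], rule exI[of _ V], rule exI[of _ \<alpha>], rule exI[of _ \<beta>],
      rule exI[of _ 1], rule exI[of _ 0], rule exI[of _ \<gamma>], rule exI[of _ \<delta>],
      rule exI[of _ 0], rule exI[of _ 1], intro conjI)
    show "vline b = span {1 *\<^sub>R U + 0 *\<^sub>R V}" "vline d = span {0 *\<^sub>R U + 1 *\<^sub>R V}"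
      unfolding b d by simp_all
  qed (use assms(1,2) a c in \<open>simp_all\<close>)
next
  fix r
  assume "\<exists>u v a1 a2 b1 b2 c1 c2 d1 d2.
     u \<noteq> v \<and> independent {u, v} \<and>
     vline a = span {a1 *\<^sub>R u + a2 *\<^sub>R v} \<and> vline b = span {b1 *\<^sub>R u + b2 *\<^sub>R v} \<and>
     vline c = span {c1 *\<^sub>R u + c2 *\<^sub>R v} \<and> vline d = span {d1 *\<^sub>R u + d2 *\<^sub>R v} \<and>
     r = ((a1 * b2 - a2 * b1) * (c1 * d2 - c2 * d1)) /
         ((b1 * c2 - b2 * c1) * (d1 * a2 - d2 * a1))"
  then obtain u v a1 a2 b1 b2 c1 c2 d1 d2 where
    uv: "u \<noteq> v" "independent {u, v}" and
    a': "vline a = span {a1 *\<^sub>R u + a2 *\<^sub>R v}" and b': "vline b = span {b1 *\<^sub>R u + b2 *\<^sub>R v}" and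
    c': "vline c = span {c1 *\<^sub>R u + c2 *\<^sub>R v}" and d': "vline d = span {d1 *\<^sub>R u + d2 *\<^sub>R v}" and
    r: "r = ((a1 * b2 - a2 * b1) * (c1 * d2 - c2 * d1)) /
         ((b1 * c2 - b2 * c1) * (d1 * a2 - d2 * a1))"
    by (elim exE conjE)
  have scale: "\<exists>k. k \<noteq> 0 \<and> w = k *\<^sub>R w'" if "vline p = span {w}" "vline p = span {w'}"
    for w w' :: 'a and p
  proof -
    have "w \<noteq> 0" using that(1) vline[of p] by (auto)
    moreover have "w \<in> span {w'}" using that by (metis span_base singletonI)
    ultimately show ?thesis by (auto simp: span_singleton)
  qed
  obtain k where k: "k \<noteq> 0" "U = k *\<^sub>R (b1 *\<^sub>R u + b2 *\<^sub>R v)" using scale[OF b b'] by blast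
  obtain l where l: "l \<noteq> 0" "V = l *\<^sub>R (d1 *\<^sub>R u + d2 *\<^sub>R v)" using scale[OF d d'] by blast
  obtain m where m: "m \<noteq> 0" "a1 *\<^sub>R u + a2 *\<^sub>R v = m *\<^sub>R (\<alpha> *\<^sub>R U + \<beta> *\<^sub>R V)"
    using scale[OF a' a] by blast
  obtain n where n: "n \<noteq> 0" "c1 *\<^sub>R u + c2 *\<^sub>R v = n *\<^sub>R (\<gamma> *\<^sub>R U + \<delta> *\<^sub>R V)"
    using scale[OF c' c] by blast
  have coeff: "s = 0 \<and> t = 0" if "s *\<^sub>R u + t *\<^sub>R v = 0" for s t
  proof -
    have e: "(\<Sum>w\<in>{u,v}. (if w = u then s else t) *\<^sub>R w) = 0" using uv that by simp
    have "(if w = u then s else t) = 0" if "w \<in> {u, v}" for w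
      using independentD[OF uv(2) _ subset_refl e that] by simp
    from this[of u] this[of v] show ?thesis using uv(1) by simp
  qed
  have eqs: "s = s' \<and> t = t'" if "s *\<^sub>R u + t *\<^sub>R v = s' *\<^sub>R u + t' *\<^sub>R v" for s t s' t'
    using coeff[of "s - s'" "t - t'"] that by (simp add: algebra_simps)
  have "a1 *\<^sub>R u + a2 *\<^sub>R v =
      (m * (\<alpha> * k * b1 + \<beta> * l * d1)) *\<^sub>R u + (m * (\<alpha> * k * b2 + \<beta> * l * d2)) *\<^sub>R v"
    unfolding m(2) k(2) l(2) by (simp add: algebra_simps)
  note A = eqs[OF this]
  have "c1 *\<^sub>R u + c2 *\<^sub>R v =
      (n * (\<gamma> * k * b1 + \<delta> * l * d1)) *\<^sub>R u + (n * (\<gamma> * k * b2 + \<delta> * l * d2)) *\<^sub>R v"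
    unfolding n(2) k(2) l(2) by (simp add: algebra_simps)
  note C = eqs[OF this]
  define t where "t = b1 * d2 - b2 * d1"
  have UV: "U \<notin> span {V}" using assms(1,2) by (simp add: independent_insert)
  have tnz: "t \<noteq> 0"
  proof
    assume t0: "t = 0"
    have Vnz: "V \<noteq> 0" using assms(2) dependent_zero by blast
    have "(d1 * l) *\<^sub>R U - (k * b1) *\<^sub>R V = - (k * l * t) *\<^sub>R v"
      unfolding k(2) l(2) t_def by (simp add: algebra_simps)
    hence 1: "(d1 * l) *\<^sub>R U = (k * b1) *\<^sub>R V" using t0 by simp
    have "(d2 * l) *\<^sub>R U - (k * b2) *\<^sub>R V = (k * l * t) *\<^sub>R u"
      unfolding k(2) l(2) t_def by (simp add: algebra_simps)
    hence 2: "(d2 * l) *\<^sub>R U = (k * b2) *\<^sub>R V" using t0 by simp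
    have "d1 * l \<noteq> 0 \<or> d2 * l \<noteq> 0" using Vnz l by auto
    then obtain p q where pq: "p \<noteq> 0" "p *\<^sub>R U = q *\<^sub>R V" using 1 2 by blast
    hence "(1 / p) *\<^sub>R (p *\<^sub>R U) = (1 / p) *\<^sub>R (q *\<^sub>R V)" by simp
    hence "U = (q / p) *\<^sub>R V" using pq(1) by simp
    thus False using UV by (metis span_base span_scale singletonI)
  qed
  have "a1 * b2 - a2 * b1 = - (m * \<beta> * l * t)" "c1 * d2 - c2 * d1 = n * \<gamma> * k * t"
    "b1 * c2 - b2 * c1 = n * \<delta> * l * t" "d1 * a2 - d2 * a1 = - (m * \<alpha> * k * t)"
    using A C by (simp_all add: t_def algebra_simps)
  hence "r = (m * n * k * l * t * t) * (\<beta> * \<gamma>) / ((m * n * k * l * t * t) * (\<alpha> * \<delta>))"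
    unfolding r by (simp add: mult_ac)
  thus "r = (\<beta> * \<gamma>) / (\<alpha> * \<delta>)" using k l m n tnz by simp
qed

lemma join_pt:
  assumes "v \<noteq> 0" "w \<noteq> 0"
  shows "join {pt v, pt w} = points_in (span {v, w})"
proof -
  have "span (span {v} \<union> span {w}) = span {v, w}"
  proof (intro subset_antisym span_minimal)
    show "span {v} \<union> span {w} \<subseteq> span {v, w}"
      using span_mono[of "{v}" "{v, w}"] span_mono[of "{w}" "{v, w}"] by auto
    show "{v, w} \<subseteq> span (span {v} \<union> span {w})"
      by (auto intro!: span_base)
  qed auto
  thus ?thesis unfolding join_def using assms by (simp add: vline_pt)
qed

lemma pt_scaleR: "v \<noteq> 0 \<Longrightarrow> k \<noteq> 0 \<Longrightarrow> pt (k *\<^sub>R v) = pt v"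
  using pt_eq_iff[of v "k *\<^sub>R v"] by (auto intro: span_scale span_base)

lemma span_pair_iff: "v \<in> span {a, b} \<longleftrightarrow> (\<exists>s t. v = s *\<^sub>R a + t *\<^sub>R b)"
proof -
  have "v \<in> span {a, b} \<longleftrightarrow> (\<exists>s t. v - s *\<^sub>R a = t *\<^sub>R b)"
    by (auto simp: span_insert[of a] span_singleton)
  thus ?thesis by (metis add.commute diff_add_cancel add_diff_cancel_left')
qed

text \<open>Write a vector off the centre and the hyperplane as \<open>\<alpha> c + h\<close> with \<open>h\<close> in
  the hyperplane. The line of the construction is spanned by \<open>c\<close> and \<open>h\<close>, and
  the harmonic conjugate with respect to these two points flips one sign, which is the effect
  of the linear involution.\<close>

lemma proj_reflection_pt:
  fixes n c :: "'a::euclidean_space"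
  assumes nc: "n \<bullet> c = 2"
  shows "proj_reflection {pt c} (points_in {v. n \<bullet> v = 0}) = pmap (refl_map n c)"
proof
  fix y :: "'a pspace"
  define H where "H = {v. n \<bullet> v = 0}"
  have sH: "subspace H" unfolding H_def by (rule subspace_hyperplane)
  have c0: "c \<noteq> 0" using nc by auto
  obtain v where v: "v \<noteq> 0" "y = pt v" by (rule pt_cases)
  have img: "pmap (refl_map n c) y = pt (refl_map n c v)"
    using v by (simp add: pmap_pt linear_refl_map)
  show "proj_reflection {pt c} (points_in {v. n \<bullet> v = 0}) y = pmap (refl_map n c) y"
  proof (cases "y \<in> {pt c} \<union> points_in H")
    case True
    have "pt (refl_map n c v) = pt v"
    proof (cases "y = pt c")
      case True
      hence "v \<in> span {c}" using v pt_eq_iff[OF c0 v(1)] by simp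
      then obtain k where k: "v = k *\<^sub>R c" by (auto simp: span_singleton)
      hence "refl_map n c v = (-1) *\<^sub>R v"
        by (simp add: refl_map_def nc scaleR_left_diff_distrib[symmetric])
      thus ?thesis using pt_scaleR[of v "-1"] v by simp
    next
      case False
      hence "v \<in> H" using \<open>y \<in> {pt c} \<union> points_in H\<close> v sH by (simp add: pt_in_points_in)
      thus ?thesis by (simp add: refl_map_def H_def)
    qed
    thus ?thesis using True v(2) img unfolding proj_reflection_def H_def by simp
  next
    case False
    define \<alpha> where "\<alpha> = (n \<bullet> v) / 2"
    define h where "h = v - \<alpha> *\<^sub>R c"
    have hH: "h \<in> H" by (simp add: H_def h_def \<alpha>_def inner_diff_right nc)
    have vH: "v \<notin> H" using False v sH by (simp add: pt_in_points_in)
    have a0: "\<alpha> \<noteq> 0" using vH by (simp add: H_def \<alpha>_def)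
    have vc: "v \<notin> span {c}" using False v pt_eq_iff[OF c0 v(1)] by auto
    have h0: "h \<noteq> 0"
    proof
      assume "h = 0"
      hence "v = \<alpha> *\<^sub>R c" by (simp add: h_def)
      thus False using vc by (simp add: span_base span_scale)
    qed
    have veq: "v = \<alpha> *\<^sub>R c + 1 *\<^sub>R h" by (simp add: h_def)
    have nv: "n \<bullet> v = \<alpha> + \<alpha>" by (simp add: \<alpha>_def)
    have Aeq: "refl_map n c v = (-\<alpha>) *\<^sub>R c + 1 *\<^sub>R h"
      unfolding refl_map_def h_def nv scaleR_left_distrib by simp
    have cnot: "c \<notin> span {g}" if "g \<in> H" for g
    proof
      assume "c \<in> span {g}"
      then obtain k where "c = k *\<^sub>R g" by (auto simp: span_singleton)
      thus False using that nc by (simp add: H_def)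
    qed
    have indep: "c \<noteq> g \<and> independent {c, g}" if "g \<in> H" "g \<noteq> 0" for g
      using cnot[OF that(1)] that(2) span_base[of c "{g}"] by (auto simp: independent_insert)
    have cr: "cross_ratio (pt (a *\<^sub>R c + b *\<^sub>R g)) (pt c) (pt (s *\<^sub>R c + t *\<^sub>R g)) (pt g)
        = (b * s) / (a * t)"
      if "g \<in> H" "g \<noteq> 0" "a *\<^sub>R c + b *\<^sub>R g \<noteq> 0" "s *\<^sub>R c + t *\<^sub>R g \<noteq> 0" for g a b s t
      using that indep[OF that(1,2)] c0 by (intro cross_ratio_coordinates) (simp_all add: vline_pt)
    have A0: "refl_map n c v \<noteq> 0"
      using refl_map_involution[OF nc, of v] v(1) by (auto simp: refl_map_def)
    have in_span: "a *\<^sub>R c + b *\<^sub>R g \<in> span {c, g}" for a b g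
      by (intro span_add span_scale span_base) auto
    have "(THE z. \<exists>p\<in>{pt c}. \<exists>q\<in>points_in H. y \<in> join {p, q} \<and> z \<in> join {p, q} \<and>
                     cross_ratio y p z q = -1) = pt (refl_map n c v)"
    proof (rule the_equality)
      have "y \<in> join {pt c, pt h}" "pt (refl_map n c v) \<in> join {pt c, pt h}"
        using in_span[of \<alpha> 1 h] in_span[of "-\<alpha>" 1 h] v h0 c0 A0 veq Aeq
        by (simp_all add: join_pt pt_in_points_in)
      moreover have "cross_ratio y (pt c) (pt (refl_map n c v)) (pt h) = -1"
        using cr[OF hH h0, of \<alpha> 1 "-\<alpha>" 1] v A0 a0 veq Aeq by simp
      moreover have "pt h \<in> points_in H" using hH h0 sH by (simp add: pt_in_points_in)
      ultimately show "\<exists>p\<in>{pt c}. \<exists>q\<in>points_in H. y \<in> join {p, q} \<and>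
          pt (refl_map n c v) \<in> join {p, q} \<and> cross_ratio y p (pt (refl_map n c v)) q = -1"
        by blast
    next
      fix z
      assume "\<exists>p\<in>{pt c}. \<exists>q\<in>points_in H. y \<in> join {p, q} \<and> z \<in> join {p, q} \<and>
                     cross_ratio y p z q = -1"
      then obtain q where q: "q \<in> points_in H" "y \<in> join {pt c, q}" "z \<in> join {pt c, q}"
        "cross_ratio y (pt c) z q = -1" by blast
      obtain g where g: "g \<noteq> 0" "q = pt g" by (rule pt_cases)
      obtain w where w: "w \<noteq> 0" "z = pt w" by (rule pt_cases)
      have gH: "g \<in> H" using q(1) g sH by (simp add: pt_in_points_in)
      have "v \<in> span {c, g}" "w \<in> span {c, g}"
        using q(2,3) v w g c0 by (simp_all add: join_pt pt_in_points_in)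
      then obtain a b s t where ab: "v = a *\<^sub>R c + b *\<^sub>R g" and st: "w = s *\<^sub>R c + t *\<^sub>R g"
        unfolding span_pair_iff by blast
      have "(b * s) / (a * t) = -1"
        using cr[OF gH g(1), of a b s t] q(4) v w g ab st by simp
      moreover have "a = \<alpha>" using gH by (simp add: \<alpha>_def ab inner_add_right nc H_def)
      ultimately have bs: "(b * s) / (\<alpha> * t) = -1" and a: "a = \<alpha>" by simp_all
      have "\<alpha> * t \<noteq> 0" using bs by (metis div_by_0 zero_neq_neg_one)
      hence "b * s = - (\<alpha> * t)" "t \<noteq> 0" using bs by (auto simp: divide_eq_eq)
      moreover from this have "b \<noteq> 0" using \<open>\<alpha> * t \<noteq> 0\<close> by auto
      moreover have "h = b *\<^sub>R g" using ab a by (simp add: h_def)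
      ultimately have "b *\<^sub>R w = t *\<^sub>R refl_map n c v"
        unfolding Aeq st by (simp add: algebra_simps)
      hence "pt (b *\<^sub>R w) = pt (t *\<^sub>R refl_map n c v)" by simp
      thus "z = pt (refl_map n c v)"
        using pt_scaleR[OF w(1) \<open>b \<noteq> 0\<close>] pt_scaleR[OF A0 \<open>t \<noteq> 0\<close>] w by simp
    qed
    thus ?thesis using False img unfolding proj_reflection_def H_def by simp
  qed
qed

text \<open>The canonical linear lift of a reflection: the functional is a multiple of the one that
  defines the hyperplane, scaled to take the value 2 at a vector representing the centre.\<close>

lemma F_opi_iff:
  fixes f :: "'a::euclidean_space pspace \<Rightarrow> 'a pspace"
  assumes "DIM('a) \<ge> 2"
  shows "f \<in> F_opi \<longleftrightarrow> (\<exists>n c. n \<bullet> c = 2 \<and> f = pmap (refl_map n c))"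
proof
  assume "f \<in> F_opi"
  then obtain p H where pH: "is_hyperplane H" "p \<notin> H" "f = proj_reflection {p} H"
    unfolding F_opi_def by blast
  then obtain W k where W: "subspace W" "dim W = k + 1" "k + 2 = DIM('a)" "H = points_in W"
    unfolding is_hyperplane_def is_flat_def by blast
  have "dim W < DIM('a)" using W by linarith
  then obtain a where a: "a \<noteq> 0" "span W \<subseteq> {x. a \<bullet> x = 0}"
    using lowdim_subset_hyperplane[of W] by blast
  hence "W \<subseteq> {x. a \<bullet> x = 0}" using W(1) by (simp add: span_eq_iff[THEN iffD2])
  hence Weq: "W = {x. a \<bullet> x = 0}"
    using W a by (intro subspace_dim_equal) (auto simp: subspace_hyperplane dim_hyperplane)
  obtain c where c: "c \<noteq> 0" "p = pt c" by (rule pt_cases)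
  have ac: "a \<bullet> c \<noteq> 0" using pH(2) c W Weq by (simp add: pt_in_points_in)
  define n where "n = (2 / (a \<bullet> c)) *\<^sub>R a"
  have nc: "n \<bullet> c = 2" using ac by (simp add: n_def)
  have "{x. n \<bullet> x = 0} = W" using ac by (auto simp: Weq n_def)
  hence "f = pmap (refl_map n c)" using proj_reflection_pt[OF nc] pH W c by simp
  thus "\<exists>n c. n \<bullet> c = 2 \<and> f = pmap (refl_map n c)" using nc by blast
next
  assume "\<exists>n c. n \<bullet> c = 2 \<and> f = pmap (refl_map n c)"
  then obtain n c where nc: "n \<bullet> c = 2" and f: "f = pmap (refl_map n c)" by blast
  have n0: "n \<noteq> 0" and c0: "c \<noteq> 0" using nc by auto
  let ?H = "points_in {x. n \<bullet> x = 0}"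
  have "is_hyperplane ?H" unfolding is_hyperplane_def is_flat_def
    using assms n0
    by (intro exI[of _ "DIM('a) - 2"] conjI exI[of _ "{x. n \<bullet> x = 0}"])
      (auto simp: subspace_hyperplane dim_hyperplane)
  moreover have "pt c \<notin> ?H" using nc c0 by (simp add: pt_in_points_in subspace_hyperplane)
  ultimately show "f \<in> F_opi" unfolding F_opi_def f
    using proj_reflection_pt[OF nc, symmetric] by blast
qed

lemma F_opi_involution:
  assumes "DIM('a::euclidean_space) \<ge> 2" "(f :: 'a pspace \<Rightarrow> 'a pspace) \<in> F_opi"
  shows "f (f p) = p"
proof -
  obtain n c where nc: "n \<bullet> c = 2" "f = pmap (refl_map n c)"
    using assms F_opi_iff by blast
  obtain v where v: "v \<noteq> 0" "p = pt v" by (rule pt_cases)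
  have "refl_map n c v \<noteq> 0"
    using refl_map_involution[OF nc(1), of v] v(1) by (auto simp: refl_map_def)
  thus ?thesis using v nc by (simp add: pmap_pt linear_refl_map refl_map_involution)
qed

text \<open>The lift of a reflection that exchanges the points represented by \<open>X\<close> and
  \<open>Y\<close>, scaled so that its functional is 1 at \<open>X\<close>. The centre is then
  \<open>X - A X\<close> with \<open>A X = b Y\<close>, and the second equation says that the functional is
  2 at the centre.\<close>

definition edge_refl :: "'a::real_inner \<Rightarrow> 'a \<Rightarrow> ('a \<Rightarrow> 'a) \<Rightarrow> bool" where
  "edge_refl X Y A \<longleftrightarrow>
     (\<exists>n b. n \<bullet> X = 1 \<and> b * (n \<bullet> Y) = -1 \<and> A = refl_map n (X - b *\<^sub>R Y))"

lemma edge_refl_linear: "edge_refl X Y A \<Longrightarrow> linear A"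
  unfolding edge_refl_def by (auto simp: linear_refl_map)

lemma edge_refl_involution: "edge_refl X Y A \<Longrightarrow> A (A v) = v"
  unfolding edge_refl_def by (auto simp: refl_map_involution inner_diff_right)

lemma edge_refl_image: "edge_refl X Y A \<Longrightarrow> \<exists>b. b \<noteq> 0 \<and> A X = b *\<^sub>R Y"
proof -
  assume "edge_refl X Y A"
  then obtain n b where "n \<bullet> X = 1" "b * (n \<bullet> Y) = -1" "A = refl_map n (X - b *\<^sub>R Y)"
    unfolding edge_refl_def by blast
  thus ?thesis by (intro exI[of _ b]) (auto simp: refl_map_def)
qed

lemma edge_refl_move: "edge_refl X Y A \<Longrightarrow> A v - v \<in> span {X, Y}"
proof -
  assume "edge_refl X Y A"
  then obtain n b where "A v - v = - ((n \<bullet> v) *\<^sub>R (X - b *\<^sub>R Y))"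
    unfolding edge_refl_def refl_map_def by auto
  moreover have "X - b *\<^sub>R Y \<in> span {X, Y}" by (intro span_diff span_scale span_base) auto
  ultimately show "A v - v \<in> span {X, Y}" by (simp add: span_neg span_scale)
qed

lemma edge_refl_sym:
  assumes "edge_refl X Y A"
  shows "edge_refl Y X A"
proof -
  obtain n b where n: "n \<bullet> X = 1" "b * (n \<bullet> Y) = -1" and A: "A = refl_map n (X - b *\<^sub>R Y)"
    using assms unfolding edge_refl_def by blast
  have b: "b \<noteq> 0" using n(2) by auto
  have "A = refl_map ((-b) *\<^sub>R n) (Y - (1 / b) *\<^sub>R X)"
    unfolding A refl_map_def using b by (auto simp: fun_eq_iff scaleR_diff_right)
  thus ?thesis unfolding edge_refl_def using n b
    by (intro exI[of _ "(-b) *\<^sub>R n"] exI[of _ "1 / b"]) simp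
qed

text \<open>Together with the symmetry in \<open>X\<close> and \<open>Y\<close>: the notion depends on the points only,
  not on the vectors that represent them.\<close>

lemma edge_refl_scale:
  assumes "edge_refl X Y A" "r \<noteq> 0"
  shows "edge_refl (r *\<^sub>R X) Y A"
proof -
  obtain n b where n: "n \<bullet> X = 1" "b * (n \<bullet> Y) = -1" and A: "A = refl_map n (X - b *\<^sub>R Y)"
    using assms unfolding edge_refl_def by blast
  have "A = refl_map ((1 / r) *\<^sub>R n) (r *\<^sub>R X - (r * b) *\<^sub>R Y)"
    unfolding A refl_map_def using assms(2) by (auto simp: fun_eq_iff scaleR_diff_right)
  thus ?thesis unfolding edge_refl_def using n assms(2)
    by (intro exI[of _ "(1 / r) *\<^sub>R n"] exI[of _ "r * b"]) simp
qed

lemma F_opi_edge_refl: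
  fixes X Y :: "'a::euclidean_space"
  assumes "DIM('a) \<ge> 2" "f \<in> F_opi" "X \<noteq> 0" "Y \<noteq> 0" "f (pt X) = pt Y" "pt X \<noteq> pt Y"
  obtains A where "edge_refl X Y A" "f = pmap A"
proof -
  obtain n c where nc: "n \<bullet> c = 2" "f = pmap (refl_map n c)"
    using assms F_opi_iff by blast
  have A0: "refl_map n c X \<noteq> 0"
    using refl_map_involution[OF nc(1), of X] assms(3) by (auto simp: refl_map_def)
  have "pt (refl_map n c X) = pt Y" using assms nc by (simp add: pmap_pt linear_refl_map)
  then obtain b where b: "refl_map n c X = b *\<^sub>R Y"
    using A0 assms(4) pt_eq_iff[of Y "refl_map n c X"] by (auto simp: span_singleton)
  define k where "k = n \<bullet> X"
  have k0: "k \<noteq> 0"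
  proof
    assume "k = 0"
    thus False using b assms \<open>pt (refl_map n c X) = pt Y\<close> by (simp add: refl_map_def k_def)
  qed
  have kc: "k *\<^sub>R c = X - b *\<^sub>R Y" using b by (simp add: refl_map_def k_def algebra_simps)
  define m where "m = (1 / k) *\<^sub>R n"
  have mX: "m \<bullet> X = 1" using k0 by (simp add: m_def k_def)
  have "m \<bullet> (k *\<^sub>R c) = 2" using k0 nc by (simp add: m_def)
  hence "b * (m \<bullet> Y) = -1" using mX unfolding kc by (simp add: inner_diff_right)
  moreover have "refl_map n c = refl_map m (X - b *\<^sub>R Y)"
    unfolding kc[symmetric] refl_map_def m_def using k0 by auto
  ultimately have "edge_refl X Y (refl_map n c)" unfolding edge_refl_def using mX by auto
  thus ?thesis using that nc by blast
qed

lemma edge_refl_F_opi: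
  fixes X Y :: "'a::euclidean_space"
  assumes "DIM('a) \<ge> 2" "edge_refl X Y A"
  shows "pmap A \<in> F_opi"
proof -
  obtain n b where "n \<bullet> X = 1" "b * (n \<bullet> Y) = -1" "A = refl_map n (X - b *\<^sub>R Y)"
    using assms(2) unfolding edge_refl_def by blast
  hence "n \<bullet> (X - b *\<^sub>R Y) = 2" "pmap A = pmap (refl_map n (X - b *\<^sub>R Y))"
    by (simp_all add: inner_diff_right)
  thus ?thesis using F_opi_iff[OF assms(1)] by blast
qed

lemma edge_refl_pt:
  assumes "edge_refl X Y A" "X \<noteq> 0" "Y \<noteq> 0"
  shows "pmap A (pt X) = pt Y"
  using edge_refl_image[OF assms(1)] assms by (auto simp: pmap_pt edge_refl_linear pt_scaleR)

text \<open>Modulo \<open>Y\<close>, reflections that exchange \<open>X\<close> and \<open>Y\<close> are the same as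
  functionals \<open>\<psi>\<close> with \<open>\<psi>(X) = 1\<close> and \<open>\<psi>(Y) \<noteq> 0\<close>: the
  multiple of \<open>Y\<close> in the centre is forced to be \<open>-1 / \<psi>(Y)\<close>. This is how
  reflections are constructed from linear data.\<close>

lemma edge_refl_exists:
  fixes X Y :: "'a::euclidean_space" and \<psi> :: "'a \<Rightarrow> real"
  assumes "linear \<psi>" "\<psi> X = 1" "\<psi> Y \<noteq> 0"
  obtains B where "edge_refl X Y B" "\<And>v. B v - (v - \<psi> v *\<^sub>R X) \<in> span {Y}"
proof -
  define n where "n = adjoint \<psi> 1"
  have n: "n \<bullet> v = \<psi> v" for v
    using adjoint_works[OF assms(1), of v 1] by (simp add: n_def inner_commute)
  define b where "b = - 1 / \<psi> Y"
  have "edge_refl X Y (refl_map n (X - b *\<^sub>R Y))"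
    unfolding edge_refl_def using assms n by (intro exI[of _ n] exI[of _ b]) (simp add: b_def)
  moreover have "refl_map n (X - b *\<^sub>R Y) v - (v - \<psi> v *\<^sub>R X) \<in> span {Y}" for v
  proof -
    have "refl_map n (X - b *\<^sub>R Y) v - (v - \<psi> v *\<^sub>R X) = (\<psi> v * b) *\<^sub>R Y"
      by (simp add: refl_map_def n scaleR_diff_right)
    thus ?thesis by (simp add: span_base span_scale)
  qed
  ultimately show ?thesis using that by blast
qed

section \<open>Propagation as a congruence of linear maps\<close>

lemma points_in_mono_iff:
  assumes "subspace W" "subspace W'"
  shows "points_in W \<subseteq> points_in W' \<longleftrightarrow> W \<subseteq> W'"
proof
  assume l: "points_in W \<subseteq> points_in W'"
  show "W \<subseteq> W'"
  proof
    fix v assume v: "v \<in> W"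
    show "v \<in> W'"
    proof (cases "v = 0")
      case True
      thus ?thesis using assms(2) by (simp add: subspace_0)
    next
      case False
      thus ?thesis using l v assms pt_in_points_in by blast
    qed
  qed
qed (auto simp: points_in_def)

lemma pmap_points_in:
  assumes "linear A" "inj A" "subspace W"
  shows "pmap A ` points_in W = points_in (A ` W)"
proof -
  have sA: "subspace (A ` W)" using assms by (simp add: linear_subspace_image)
  have A0: "A v \<noteq> 0" if "v \<noteq> 0" for v
    using that assms(1,2) by (metis injD linear_0)
  show ?thesis
  proof (intro subset_antisym subsetI)
    fix q assume "q \<in> pmap A ` points_in W"
    then obtain p where p: "p \<in> points_in W" "q = pmap A p" by blast
    obtain v where v: "v \<noteq> 0" "p = pt v" by (rule pt_cases)
    have "v \<in> W" using p v assms(3) by (simp add: pt_in_points_in)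
    thus "q \<in> points_in (A ` W)" using p v A0 sA assms(1)
      by (simp add: pmap_pt pt_in_points_in)
  next
    fix q assume q: "q \<in> points_in (A ` W)"
    obtain w where w: "w \<noteq> 0" "q = pt w" by (rule pt_cases)
    have "w \<in> A ` W" using q w sA by (simp add: pt_in_points_in)
    then obtain v where v: "v \<in> W" "w = A v" by blast
    have v0: "v \<noteq> 0" using v w assms(1) by (metis linear_0)
    have "q = pmap A (pt v)" using v v0 w assms(1) by (simp add: pmap_pt)
    moreover have "pt v \<in> points_in W" using v v0 assms(3) by (simp add: pt_in_points_in)
    ultimately show "q \<in> pmap A ` points_in W" by blast
  qed
qed

lemma edge_refl_inj: "edge_refl X Y A \<Longrightarrow> inj A"
  by (metis edge_refl_involution injI)

lemma pmap_edge_refl_line: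
  assumes "edge_refl X Y A" "edge_refl X' Y' B" "subspace W"
  shows "(pmap B \<circ> pmap A) ` points_in W = points_in ((\<lambda>v. B (A v)) ` W)"
proof -
  have "subspace (A ` W)" using assms by (simp add: linear_subspace_image edge_refl_linear)
  hence "pmap B ` (pmap A ` points_in W) = points_in (B ` (A ` W))" using assms
    by (simp add: pmap_points_in[OF edge_refl_linear edge_refl_inj])
  thus ?thesis by (simp add: image_comp o_def)
qed

lemma edge_refl_move_in:
  assumes "edge_refl X Y A" "X \<in> S" "Y \<in> S" "subspace S"
  shows "A v - v \<in> S"
  using edge_refl_move[OF assms(1), of v] span_minimal[of "{X, Y}" S] assms by auto

text \<open>Equality on all lines through the point of \<open>X\<close> gives, for each \<open>v\<close> outside the
  span \<open>S\<close> of the quadrilateral, a factor \<open>t\<close> with \<open>M v = t K v\<close>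
  modulo \<open>X12\<close>. As \<open>M\<close> and \<open>K\<close> are the identity modulo \<open>S\<close>,
  that factor is 1. The vectors satisfying the resulting congruence form a subspace that
  contains the complement of the proper subspace \<open>S\<close>, so it is everything.\<close>

lemma propagates_iff:
  fixes X X1 X2 X12 :: "'a::euclidean_space"
  assumes dim: "DIM('a) \<ge> 4"
    and nz: "X \<noteq> 0" "X1 \<noteq> 0" "X2 \<noteq> 0" "X12 \<noteq> 0"
    and A: "edge_refl X X1 A1" "edge_refl X X2 A2"
    and B: "edge_refl X2 X12 B1" "edge_refl X1 X12 B2"
    and plane: "X12 \<in> span {X, X1, X2}"
  shows "propagates (pt X) (pt X1) (pt X12) (pt X2) (pmap A1) (pmap A2) (pmap B1) (pmap B2)
    \<longleftrightarrow> (\<forall>v. B2 (A1 v) - B1 (A2 v) \<in> span {X12})"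
proof -
  define M where "M = (\<lambda>v. B2 (A1 v))"
  define K where "K = (\<lambda>v. B1 (A2 v))"
  have lin: "linear M" "linear K"
    unfolding M_def K_def
    using linear_compose[OF edge_refl_linear[OF A(1)] edge_refl_linear[OF B(2)]]
      linear_compose[OF edge_refl_linear[OF A(2)] edge_refl_linear[OF B(1)]]
    by (simp_all add: o_def)
  have img: "(pmap B2 \<circ> pmap A1) ` points_in W = points_in (M ` W)"
    "(pmap B1 \<circ> pmap A2) ` points_in W = points_in (K ` W)" if "subspace W" for W
    unfolding M_def K_def
    by (rule pmap_edge_refl_line[OF A(1) B(2) that], rule pmap_edge_refl_line[OF A(2) B(1) that])
  have vertex: "\<exists>s. s \<noteq> 0 \<and> B (A X) = s *\<^sub>R X12"
    if e: "edge_refl X Y A" "edge_refl Y X12 B" for A B Y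
  proof -
    obtain a b where "a \<noteq> 0" "A X = a *\<^sub>R Y" "b \<noteq> 0" "B Y = b *\<^sub>R X12"
      using edge_refl_image[OF e(1)] edge_refl_image[OF e(2)] by blast
    thus ?thesis using linear_cmul[OF edge_refl_linear[OF e(2)], of a Y]
      by (intro exI[of _ "a * b"]) auto
  qed
  have MX: "\<exists>s. s \<noteq> 0 \<and> M X = s *\<^sub>R X12" and KX: "\<exists>s. s \<noteq> 0 \<and> K X = s *\<^sub>R X12"
    unfolding M_def K_def using vertex A B by blast+
  have lines: "(\<forall>l. is_line l \<and> pt X \<in> l \<longrightarrow> (pmap B2 \<circ> pmap A1) ` l = (pmap B1 \<circ> pmap A2) ` l)
    \<longleftrightarrow> (\<forall>W. subspace W \<and> dim W = 2 \<and> X \<in> W \<longrightarrow> M ` W = K ` W)" (is "?L \<longleftrightarrow> ?R")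
  proof
    assume L: ?L
    show ?R
    proof (intro allI impI)
      fix W assume W: "subspace W \<and> dim W = 2 \<and> X \<in> W"
      hence "is_line (points_in W)" unfolding is_line_def is_flat_def by auto
      moreover have "pt X \<in> points_in W" using W nz by (simp add: pt_in_points_in)
      ultimately have "points_in (M ` W) = points_in (K ` W)" using L img W by metis
      moreover have "subspace (M ` W)" "subspace (K ` W)"
        using lin W by (simp_all add: linear_subspace_image)
      ultimately show "M ` W = K ` W" by (metis points_in_mono_iff subset_antisym order_refl)
    qed
  next
    assume R: ?R
    show ?L
    proof (intro allI impI)
      fix l assume l: "is_line l \<and> pt X \<in> l"
      then obtain W where W: "subspace W" "dim W = 2" "l = points_in W"
        unfolding is_line_def is_flat_def by auto
      hence "X \<in> W" using l nz by (simp add: pt_in_points_in)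
      thus "(pmap B2 \<circ> pmap A1) ` l = (pmap B1 \<circ> pmap A2) ` l" using R W img by simp
    qed
  qed
  have "DIM('a) \<ge> 2" using dim by simp
  hence "propagates (pt X) (pt X1) (pt X12) (pt X2) (pmap A1) (pmap A2) (pmap B1) (pmap B2) \<longleftrightarrow> ?R"
    unfolding propagates_def lines[symmetric] using B nz
    by (auto simp: edge_refl_F_opi edge_refl_pt)
  also have "\<dots> \<longleftrightarrow> (\<forall>v. M v - K v \<in> span {X12})"
  proof
    assume R: ?R
    define S where "S = span {X, X1, X2}"
    have S: "subspace S" "X \<in> S" "X1 \<in> S" "X2 \<in> S" "X12 \<in> S"
      using plane by (auto simp: S_def span_base)
    have dS: "dim S \<le> 3"
    proof -
      have "dim S \<le> card {X, X1, X2}" unfolding S_def by (simp add: dim_le_card')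
      also have "\<dots> \<le> 3" by (simp add: card_insert_if)
      finally show ?thesis .
    qed
    have MS: "M v - v \<in> S" and KS: "K v - v \<in> S" for v
    proof -
      have "(B2 (A1 v) - A1 v) + (A1 v - v) \<in> S"
        using S by (intro subspace_add edge_refl_move_in[OF A(1)] edge_refl_move_in[OF B(2)])
      thus "M v - v \<in> S" by (simp add: M_def)
      have "(B1 (A2 v) - A2 v) + (A2 v - v) \<in> S"
        using S by (intro subspace_add edge_refl_move_in[OF A(2)] edge_refl_move_in[OF B(1)])
      thus "K v - v \<in> S" by (simp add: K_def)
    qed
    have off: "M v - K v \<in> span {X12}" if v: "v \<notin> S" for v
    proof -
      have "span {X} \<subseteq> S" using S by (intro span_minimal) auto
      hence "dim (span {X, v}) = 2" using v nz
        by (auto simp: dim_insert insert_commute[of X v])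
      hence "M ` span {X, v} = K ` span {X, v}" using R by (simp add: span_base)
      moreover have "M v \<in> M ` span {X, v}" by (simp add: span_base)
      ultimately obtain w where w: "w \<in> span {X, v}" "M v = K w" by auto
      obtain s t where "w = s *\<^sub>R X + t *\<^sub>R v" using w span_pair_iff by blast
      hence Mv: "M v = s *\<^sub>R K X + t *\<^sub>R K v"
        using w lin by (simp add: linear_add linear_cmul)
      obtain r where r: "K X = r *\<^sub>R X12" using KX by blast
      have "s *\<^sub>R K X \<in> S" using r S by (simp add: subspace_scale)
      moreover have "(1 - t) *\<^sub>R v = s *\<^sub>R K X + t *\<^sub>R (K v - v) - (M v - v)"
        unfolding Mv by (simp add: algebra_simps)
      ultimately have in_S: "(1 - t) *\<^sub>R v \<in> S"
        using MS KS S by (simp add: subspace_add subspace_diff subspace_scale)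
      have "t = 1"
      proof (rule ccontr)
        assume "t \<noteq> 1"
        hence "v = (1 / (1 - t)) *\<^sub>R ((1 - t) *\<^sub>R v)" by simp
        hence "v \<in> S" using in_S S(1) subspace_scale by metis
        thus False using v by simp
      qed
      hence "M v - K v = (s * r) *\<^sub>R X12" using Mv r by simp
      thus ?thesis by (simp add: span_base span_scale)
    qed
    have "S \<noteq> UNIV" using dS dim by auto
    then obtain u where u: "u \<notin> S" by auto
    show "\<forall>v. M v - K v \<in> span {X12}"
    proof
      fix v
      show "M v - K v \<in> span {X12}"
      proof (cases "v \<in> S")
        case True
        \<comment> \<open>\<open>v\<close> is the difference of the vectors \<open>u + v\<close> and \<open>u\<close>, both outside \<open>S\<close>.\<close>
        hence "u + v \<notin> S" using u S(1) by (metis add_diff_cancel_right' subspace_diff)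
        hence "(M (u + v) - K (u + v)) - (M u - K u) \<in> span {X12}"
          using span_diff[OF off off[OF u]] by blast
        thus ?thesis using lin by (simp add: linear_add)
      qed (rule off)
    qed
  next
    assume C: "\<forall>v. M v - K v \<in> span {X12}"
    \<comment> \<open>An error in \<open>span {X12}\<close> can be absorbed in the argument, because \<open>g X\<close> spans that line and \<open>X\<close> is in \<open>W\<close>.\<close>
    have sub: "f ` W \<subseteq> g ` W" if fg: "linear f" "linear g" "\<And>v. f v - g v \<in> span {X12}"
      "\<exists>s. s \<noteq> 0 \<and> g X = s *\<^sub>R X12" and W: "subspace W" "X \<in> W" for f g :: "'a \<Rightarrow> 'a" and W
    proof
      fix y assume "y \<in> f ` W"
      then obtain w where w: "w \<in> W" "y = f w" by blast
      obtain s where s: "s \<noteq> 0" "g X = s *\<^sub>R X12" using fg by blast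
      obtain k where k: "f w - g w = k *\<^sub>R X12" using fg(3)[of w] by (auto simp: span_singleton)
      have "y = g (w + (k / s) *\<^sub>R X)"
        using k s w(2) fg(2) by (simp add: linear_add linear_cmul algebra_simps)
      moreover have "w + (k / s) *\<^sub>R X \<in> W" using w W by (simp add: subspace_add subspace_scale)
      ultimately show "y \<in> g ` W" by blast
    qed
    have C': "K v - M v \<in> span {X12}" for v
      using C span_neg[of "M v - K v" "{X12}"] by simp
    show ?R using sub[OF lin, OF _ KX] sub[OF lin(2,1), OF _ MX] C C' by blast
  qed
  finally show ?thesis unfolding M_def K_def .
qed

text \<open>Subtracting the two congruences, the difference of \<open>B1\<close> and \<open>C1\<close> stays in
  \<open>span {X2, X12}\<close>, whereas \<open>B2\<close> and \<open>C2\<close> differ by a multiple of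
  \<open>X1\<close> modulo \<open>X12\<close>. A functional \<open>e\<close> that separates \<open>X1\<close>
  from \<open>X2\<close> and \<open>X12\<close> reads off that this multiple is zero. Exchanging the
  roles of the two directions gives \<open>B1 = C1\<close>.\<close>

lemma congruence_determines_reflection:
  fixes X1 X2 X12 :: "'a::euclidean_space"
  assumes surj: "\<And>v. A1 (A1 v) = v"
    and B: "edge_refl X1 X12 B2" "edge_refl X1 X12 C2"
      "edge_refl X2 X12 B1" "edge_refl X2 X12 C1"
    and BB: "\<And>v. B2 (A1 v) - B1 (A2 v) \<in> span {X12}"
    and CC: "\<And>v. C2 (A1 v) - C1 (A2 v) \<in> span {X12}"
    and indep: "X1 \<notin> span {X2, X12}"
  shows "B2 = C2"
proof -
  let ?S = "span {X2, X12}"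
  obtain e where e: "\<And>x. x \<in> ?S \<Longrightarrow> e \<bullet> x = 0" "e \<bullet> X1 = 1"
    using dual_vector[OF indep] by blast
  have X12: "e \<bullet> X12 = 0" using e(1) by (simp add: span_base)
  obtain n b where n: "b * (n \<bullet> X12) = -1" and B2: "B2 = refl_map n (X1 - b *\<^sub>R X12)"
    using B(1) unfolding edge_refl_def by blast
  obtain m c where m: "c * (m \<bullet> X12) = -1" and C2: "C2 = refl_map m (X1 - c *\<^sub>R X12)"
    using B(2) unfolding edge_refl_def by blast
  have "n \<bullet> v = m \<bullet> v" for v
  proof -
    have up: "span {X12} \<subseteq> ?S" by (intro span_mono) auto
    have "B2 v - B1 (A2 (A1 v)) \<in> ?S" "C2 v - C1 (A2 (A1 v)) \<in> ?S"
      using BB[of "A1 v"] CC[of "A1 v"] up surj by auto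
    hence "(B2 v - B1 (A2 (A1 v))) - (C2 v - C1 (A2 (A1 v)))
        + ((B1 (A2 (A1 v)) - A2 (A1 v)) - (C1 (A2 (A1 v)) - A2 (A1 v))) \<in> ?S"
      using edge_refl_move[OF B(3)] edge_refl_move[OF B(4)] by (metis span_add span_diff)
    hence "B2 v - C2 v \<in> ?S" by (simp add: algebra_simps)
    hence "e \<bullet> (B2 v - C2 v) = 0" by (rule e(1))
    thus ?thesis unfolding B2 C2 refl_map_def
      using e(2) X12 by (simp add: inner_diff_right)
  qed
  hence nm: "n = m" using vector_eq_rdot[of n m] by blast
  hence "b = c" using n m by (metis mult_cancel_right mult_zero_right neg_equal_0_iff_equal zero_neq_one)
  thus ?thesis using nm B2 C2 by simp
qed

lemma span_triple_iff: "v \<in> span {a, b, c} \<longleftrightarrow> (\<exists>r s t. v = r *\<^sub>R a + s *\<^sub>R b + t *\<^sub>R c)"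
proof -
  have "v \<in> span {a, b, c} \<longleftrightarrow> (\<exists>r s t. v - r *\<^sub>R a = s *\<^sub>R b + t *\<^sub>R c)"
    by (simp add: span_insert[of a] span_pair_iff)
  thus ?thesis by (simp add: algebra_simps)
qed

text \<open>Let \<open>Y1 = A1 X\<close>, \<open>Y2 = A2 X\<close> and \<open>X12 / a = X + k Y1 + l Y2\<close>. With
  reflections of the form \<open>v - \<psi>2(v) Y1\<close> and \<open>v - \<psi>1(v) Y2\<close> modulo \<open>X12\<close>,
  the difference of both sides of the congruence lies in \<open>span {X, Y1, Y2}\<close>. Its
  coefficient at \<open>X\<close> is \<open>\<theta> = n2 - n1\<close>, so this difference must be
  \<open>\<theta>(v) / a\<close> times \<open>X12\<close>, and the coefficients at \<open>Y1\<close> and \<open>Y2\<close>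
  give \<open>\<psi>2\<close> and \<open>\<psi>1\<close>.\<close>

lemma congruence_solvable:
  fixes X X1 X2 X12 :: "'a::euclidean_space"
  assumes A: "edge_refl X X1 A1" "edge_refl X X2 A2"
    and plane: "X12 \<in> span {X, X1, X2}" and indep: "X12 \<notin> span {X1, X2}"
    and gen: "A1 X12 \<notin> span {X, A2 X12}" "A2 X12 \<notin> span {X, A1 X12}"
  obtains B1 B2 where "edge_refl X2 X12 B1" "edge_refl X1 X12 B2"
    "\<And>v. B2 (A1 v) - B1 (A2 v) \<in> span {X12}"
proof -
  obtain n1 b1 where n1: "n1 \<bullet> X = 1" "b1 * (n1 \<bullet> X1) = -1"
    and A1: "A1 = refl_map n1 (X - b1 *\<^sub>R X1)" using A(1) unfolding edge_refl_def by blast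
  obtain n2 b2 where n2: "n2 \<bullet> X = 1" "b2 * (n2 \<bullet> X2) = -1"
    and A2: "A2 = refl_map n2 (X - b2 *\<^sub>R X2)" using A(2) unfolding edge_refl_def by blast
  define Y1 where "Y1 = b1 *\<^sub>R X1"
  define Y2 where "Y2 = b2 *\<^sub>R X2"
  have b: "b1 \<noteq> 0" "b2 \<noteq> 0" using n1 n2 by auto
  have A1v: "A1 v = v - (n1 \<bullet> v) *\<^sub>R (X - Y1)" and A2v: "A2 v = v - (n2 \<bullet> v) *\<^sub>R (X - Y2)" for v
    by (simp_all add: A1 A2 refl_map_def Y1_def Y2_def)
  note inv = edge_refl_involution[OF A(1)] edge_refl_involution[OF A(2)]
  note lin = edge_refl_linear[OF A(1)] edge_refl_linear[OF A(2)]
  have AX: "A1 X = Y1" "A2 X = Y2" using n1 n2 by (simp_all add: A1v A2v)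
  hence AY: "A1 Y1 = X" "A2 Y2 = X" using inv by metis+
  obtain a b' d' where abd: "X12 = a *\<^sub>R X + b' *\<^sub>R X1 + d' *\<^sub>R X2"
    using plane span_triple_iff by blast
  have a: "a \<noteq> 0"
  proof
    assume "a = 0"
    hence "X12 = b' *\<^sub>R X1 + d' *\<^sub>R X2" using abd by simp
    thus False using indep span_pair_iff by blast
  qed
  define k where "k = b' / (a * b1)"
  define l where "l = d' / (a * b2)"
  have X12: "(1 / a) *\<^sub>R X12 = X + k *\<^sub>R Y1 + l *\<^sub>R Y2"
    using a b by (simp add: abd k_def l_def Y1_def Y2_def scaleR_add_right)
  define \<theta> where "\<theta> v = n2 \<bullet> v - n1 \<bullet> v" for v
  define \<psi>2 where "\<psi>2 v = n1 \<bullet> A1 v - k * \<theta> (A1 v)" for v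
  define \<psi>1 where "\<psi>1 v = n2 \<bullet> A2 v + l * \<theta> (A2 v)" for v
  have \<theta>X: "\<theta> X = 0" by (simp add: \<theta>_def n1 n2)
  have lpsi: "linear \<psi>1" "linear \<psi>2"
    unfolding \<psi>1_def \<psi>2_def \<theta>_def using lin
    by (auto intro!: linearI simp: linear_add linear_cmul inner_add_right algebra_simps)
  have psi1: "\<psi>1 Y2 = 1" "\<psi>2 Y1 = 1" by (simp_all add: \<psi>1_def \<psi>2_def AY \<theta>X n1 n2)
  have key: "(A1 v - \<psi>2 (A1 v) *\<^sub>R Y1) - (A2 v - \<psi>1 (A2 v) *\<^sub>R Y2) = (\<theta> v / a) *\<^sub>R X12" for v
  proof -
    have "(\<theta> v / a) *\<^sub>R X12 = \<theta> v *\<^sub>R (X + k *\<^sub>R Y1 + l *\<^sub>R Y2)"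
      unfolding X12[symmetric] by simp
    thus ?thesis unfolding \<psi>1_def \<psi>2_def inv by (simp add: A1v A2v \<theta>_def algebra_simps)
  qed
  have AinX: "A v \<in> span {X, A X12}" if AY: "linear A" "A Y = X" "v \<in> span {Y, X12}" for A Y v
  proof -
    obtain s t where "v = s *\<^sub>R Y + t *\<^sub>R X12" using AY(3) span_pair_iff by blast
    hence "A v = s *\<^sub>R X + t *\<^sub>R A X12" using AY by (simp add: linear_add linear_cmul)
    thus ?thesis using span_pair_iff by blast
  qed
  \<comment> \<open>If \<open>\<psi>2 X12 = 0\<close>, both sides of the congruence vanish modulo \<open>X12\<close> at \<open>A1 X12\<close>. The right-hand side vanishes only on \<open>span {X, A2 X12}\<close>, against genericity.\<close>
  have nz2: "\<psi>2 X12 \<noteq> 0"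
  proof
    assume "\<psi>2 X12 = 0"
    hence "X12 - (A2 (A1 X12) - \<psi>1 (A2 (A1 X12)) *\<^sub>R Y2) = (\<theta> (A1 X12) / a) *\<^sub>R X12"
      using key[of "A1 X12"] inv by simp
    hence "A2 (A1 X12) = \<psi>1 (A2 (A1 X12)) *\<^sub>R Y2 + (1 - \<theta> (A1 X12) / a) *\<^sub>R X12"
      by (simp add: algebra_simps)
    hence "A2 (A1 X12) \<in> span {Y2, X12}" using span_pair_iff by blast
    from AinX[OF lin(2) AY(2) this] show False using gen inv by simp
  qed
  have nz1: "\<psi>1 X12 \<noteq> 0"
  proof
    assume "\<psi>1 X12 = 0"
    hence "(A1 (A2 X12) - \<psi>2 (A1 (A2 X12)) *\<^sub>R Y1) - X12 = (\<theta> (A2 X12) / a) *\<^sub>R X12"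
      using key[of "A2 X12"] inv by simp
    hence "A1 (A2 X12) = \<psi>2 (A1 (A2 X12)) *\<^sub>R Y1 + (1 + \<theta> (A2 X12) / a) *\<^sub>R X12"
      by (simp add: algebra_simps)
    hence "A1 (A2 X12) \<in> span {Y1, X12}" using span_pair_iff by blast
    from AinX[OF lin(1) AY(1) this] show False using gen inv by simp
  qed
  obtain B1 where B1: "edge_refl Y2 X12 B1" "\<And>v. B1 v - (v - \<psi>1 v *\<^sub>R Y2) \<in> span {X12}"
    using edge_refl_exists[OF lpsi(1) psi1(1) nz1] by blast
  obtain B2 where B2: "edge_refl Y1 X12 B2" "\<And>v. B2 v - (v - \<psi>2 v *\<^sub>R Y1) \<in> span {X12}"
    using edge_refl_exists[OF lpsi(2) psi1(2) nz2] by blast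
  have "B2 (A1 v) - B1 (A2 v) \<in> span {X12}" for v
  proof -
    have "(B2 (A1 v) - (A1 v - \<psi>2 (A1 v) *\<^sub>R Y1)) - (B1 (A2 v) - (A2 v - \<psi>1 (A2 v) *\<^sub>R Y2))
      + ((A1 v - \<psi>2 (A1 v) *\<^sub>R Y1) - (A2 v - \<psi>1 (A2 v) *\<^sub>R Y2)) \<in> span {X12}"
      unfolding key[of v] by (intro span_add span_diff B1 B2 span_scale span_base) auto
    thus ?thesis by simp
  qed
  moreover have "edge_refl X2 X12 B1" "edge_refl X1 X12 B2"
    using edge_refl_scale[OF B1(1), of "1 / b2"] edge_refl_scale[OF B2(1), of "1 / b1"] b
    by (simp_all add: Y1_def Y2_def)
  ultimately show ?thesis using that by blast
qed

text \<open>The map \<open>D\<close> transports along \<open>X23, X2, X12, X123\<close>. It moves vectors within the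
  space of the face \<open>X2, X12, X123, X23\<close>. Transport along \<open>X23, X3, X13, X123\<close>
  moves them within that of the face \<open>X3, X13, X123, X23\<close>, and by the congruences for the
  three faces at \<open>X\<close> and the face at \<open>X1\<close> both agree modulo \<open>X123\<close>.
  As the cube is not flat, the two spaces meet in \<open>span {X23, X123}\<close>, so modulo
  \<open>X123\<close> the map \<open>D\<close> has the form \<open>v - \<psi>(v) X23\<close> and comes from a
  reflection.\<close>

lemma cube_closes:
  fixes X1 :: "'a::euclidean_space"
  assumes A: "edge_refl X X1 A1" "edge_refl X X2 A2" "edge_refl X X3 A3"
    and A12: "edge_refl X2 X12 A12" and A21: "edge_refl X1 X12 A21"
    and A13: "edge_refl X3 X13 A13" and A31: "edge_refl X1 X13 A31"
    and A23: "edge_refl X3 X23 A23" and A32: "edge_refl X2 X23 A32"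
    and C2: "edge_refl X13 X123 C2" and C3: "edge_refl X12 X123 C3"
    and H12: "\<And>v. A21 (A1 v) - A12 (A2 v) \<in> span {X12}"
    and H13: "\<And>v. A31 (A1 v) - A13 (A3 v) \<in> span {X13}"
    and H23: "\<And>v. A32 (A2 v) - A23 (A3 v) \<in> span {X23}"
    and H1: "\<And>v. C3 (A21 v) - C2 (A31 v) \<in> span {X123}"
    and nz: "X123 \<noteq> 0"
    and plane2: "X12 \<in> span {X2, X23, X123}" and plane3: "X13 \<in> span {X3, X23, X123}"
    and indep: "X23 \<notin> span {X123}" "X2 \<notin> span {X3, X23, X123}"
  obtains C1 where "edge_refl X23 X123 C1" "\<And>v. C3 (A12 v) - C1 (A32 v) \<in> span {X123}"
proof -
  have step: "C u - C w \<in> span {Z}" if C: "edge_refl Y Z C" "u - w \<in> span {Y}" for C Y Z u w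
  proof -
    obtain k where k: "u - w = k *\<^sub>R Y" using C(2) by (auto simp: span_singleton)
    obtain b where b: "C Y = b *\<^sub>R Z" using edge_refl_image[OF C(1)] by blast
    have "C u - C w = (k * b) *\<^sub>R Z"
      using k b edge_refl_linear[OF C(1)] by (metis linear_cmul linear_diff scaleR_scaleR)
    thus ?thesis by (simp add: span_base span_scale)
  qed
  have trans: "u - w \<in> span {Z}" if "u - v \<in> span {Z}" "v - w \<in> span {Z}" for u v w Z :: 'a
    using span_add[OF that] by simp
  have flip: "u - w \<in> span {Z}" if "w - u \<in> span {Z}" for u w Z :: 'a
    using span_neg[OF that] by simp
  define D where "D = (\<lambda>v. C3 (A12 (A32 v)))"
  have linD: "linear D"
    using linear_compose[OF linear_compose[OF edge_refl_linear[OF A32] edge_refl_linear[OF A12]]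
        edge_refl_linear[OF C3]] by (simp add: D_def o_def)
  have DX23: "D X23 \<in> span {X123}"
    using step[OF C3 step[OF A12 step[OF edge_refl_sym[OF A32], of X23 0]]]
      linear_0[OF linD] by (simp add: D_def span_base)
  have D_other: "D v - C2 (A13 (A23 v)) \<in> span {X123}" for v
  proof -
    \<comment> \<open>Pull \<open>v\<close> back to the vertex \<open>X\<close>, where the faces can be compared one after the other.\<close>
    define u where "u = A3 (A23 v)"
    have v: "A23 (A3 u) = v" by (simp add: u_def edge_refl_involution[OF A(3)] edge_refl_involution[OF A23])
    have "v - A32 (A2 u) \<in> span {X23}" using flip[OF H23[of u]] v by simp
    from step[OF edge_refl_sym[OF A32] this]
    have "A32 v - A2 u \<in> span {X2}" by (simp add: edge_refl_involution[OF A32])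
    from trans[OF step[OF A12 this] flip[OF H12]]
    have "A12 (A32 v) - A21 (A1 u) \<in> span {X12}" .
    from trans[OF step[OF C3 this] H1]
    have "D v - C2 (A31 (A1 u)) \<in> span {X123}" unfolding D_def .
    moreover have "C2 (A31 (A1 u)) - C2 (A13 (A3 u)) \<in> span {X123}"
      by (rule step[OF C2 H13])
    moreover have "A3 u = A23 v" by (simp add: u_def edge_refl_involution[OF A(3)])
    ultimately show ?thesis using trans by metis
  qed
  obtain e where e: "\<And>x. x \<in> span {X3, X23, X123} \<Longrightarrow> e \<bullet> x = 0" "e \<bullet> X2 = 1"
    using dual_vector[OF indep(2)] by blast
  have Dmove: "D v - v \<in> span {X23, X123}" for v
  proof -
    have "(C3 (A12 (A32 v)) - A12 (A32 v)) + ((A12 (A32 v) - A32 v) + (A32 v - v)) \<in> span {X2, X23, X123}"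
      using plane2
      by (intro span_add edge_refl_move_in[OF C3] edge_refl_move_in[OF A12] edge_refl_move_in[OF A32])
        (auto simp: span_base)
    hence "D v - v \<in> span {X2, X23, X123}" by (simp add: D_def)
    then obtain r s t where rst: "D v - v = r *\<^sub>R X2 + s *\<^sub>R X23 + t *\<^sub>R X123"
      using span_triple_iff by blast
    have "(C2 (A13 (A23 v)) - A13 (A23 v)) + ((A13 (A23 v) - A23 v) + (A23 v - v)) \<in> span {X3, X23, X123}"
      using plane3
      by (intro span_add edge_refl_move_in[OF C2] edge_refl_move_in[OF A13] edge_refl_move_in[OF A23])
        (auto simp: span_base)
    moreover have "D v - C2 (A13 (A23 v)) \<in> span {X3, X23, X123}"
      using D_other span_mono[of "{X123}" "{X3, X23, X123}"] by blast
    ultimately have "D v - C2 (A13 (A23 v)) + ((C2 (A13 (A23 v)) - A13 (A23 v))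
        + ((A13 (A23 v) - A23 v) + (A23 v - v))) \<in> span {X3, X23, X123}"
      by (rule span_add[rotated])
    hence "e \<bullet> (D v - v) = 0" using e(1) by simp
    moreover have "e \<bullet> X23 = 0" "e \<bullet> X123 = 0" using e(1) by (simp_all add: span_base)
    ultimately have "r = 0" unfolding rst using e(2) by (simp add: inner_add_right)
    hence "D v - v = s *\<^sub>R X23 + t *\<^sub>R X123" using rst by simp
    thus ?thesis using span_pair_iff by blast
  qed
  obtain a where a: "\<And>x. x \<in> span {X123} \<Longrightarrow> a \<bullet> x = 0" "a \<bullet> X23 = 1"
    using dual_vector[OF indep(1)] by blast
  have aX: "a \<bullet> X123 = 0" using a(1) by (simp add: span_base)
  define \<psi> where "\<psi> v = a \<bullet> (v - D v)" for v
  have D_psi: "D v - (v - \<psi> v *\<^sub>R X23) \<in> span {X123}" for v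
  proof -
    obtain s t where st: "D v - v = s *\<^sub>R X23 + t *\<^sub>R X123" using Dmove span_pair_iff by blast
    have "\<psi> v = - (a \<bullet> (D v - v))" by (simp add: \<psi>_def inner_diff_right)
    hence "\<psi> v = - s" unfolding st using a(2) aX by (simp add: inner_add_right)
    hence "D v - (v - \<psi> v *\<^sub>R X23) = t *\<^sub>R X123" using st by (simp add: algebra_simps)
    thus ?thesis by (simp add: span_base span_scale)
  qed
  have lpsi: "linear \<psi>" unfolding \<psi>_def using linD
    by (auto intro!: linearI simp: linear_add linear_cmul inner_add_right inner_diff_right algebra_simps)
  have psi1: "\<psi> X23 = 1" using a DX23 by (simp add: \<psi>_def inner_diff_right)
  \<comment> \<open>If \<open>\<psi> X123 = 0\<close>, then \<open>D\<close> would map both \<open>X23\<close> and \<open>X123\<close> into one line, although all factors of \<open>D\<close> are involutions.\<close>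
  have psi0: "\<psi> X123 \<noteq> 0"
  proof
    assume "\<psi> X123 = 0"
    hence "D X123 - X123 \<in> span {X123}" using D_psi[of X123] by simp
    hence DX: "D X123 - 0 \<in> span {X123}" using trans[of "D X123" X123 X123 0] by (simp add: span_base)
    have "A32 (A12 (C3 (D X123))) - A32 (A12 (C3 0)) \<in> span {X23}"
      using step[OF A32 step[OF edge_refl_sym[OF A12] step[OF edge_refl_sym[OF C3] DX]]] .
    hence "X123 \<in> span {X23}"
      by (simp add: D_def edge_refl_involution[OF A32] edge_refl_involution[OF A12]
          edge_refl_involution[OF C3] linear_0[OF edge_refl_linear[OF C3]]
          linear_0[OF edge_refl_linear[OF A12]] linear_0[OF edge_refl_linear[OF A32]])
    then obtain k where k: "X123 = k *\<^sub>R X23" by (auto simp: span_singleton)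
    hence "k \<noteq> 0" using nz by auto
    hence "X23 = (1 / k) *\<^sub>R X123" using k by simp
    thus False using indep(1) by (metis span_base span_scale singletonI)
  qed
  obtain C1 where C1: "edge_refl X23 X123 C1" "\<And>v. C1 v - (v - \<psi> v *\<^sub>R X23) \<in> span {X123}"
    using edge_refl_exists[OF lpsi psi1 psi0] by blast
  have "C3 (A12 v) - C1 (A32 v) \<in> span {X123}" for v
    using trans[OF D_psi[of "A32 v"] flip[OF C1(2)[of "A32 v"]]]
    by (simp add: D_def edge_refl_involution[OF A32])
  thus ?thesis using that C1(1) by blast
qed

section \<open>Propagation across one quadrilateral and around a cube\<close>

definition planar_quad ::
  "'a::euclidean_space pspace \<Rightarrow> 'a pspace \<Rightarrow> 'a pspace \<Rightarrow> 'a pspace \<Rightarrow> bool" where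
  "planar_quad a b c d \<longleftrightarrow> on_plane {a, b, c, d} \<and> nondegenerate_quad a b c d"

lemma planar_quad_swap: "planar_quad a b c d \<Longrightarrow> planar_quad a d c b"
  unfolding planar_quad_def nondegenerate_quad_def by (simp add: insert_commute)

lemma planar_quad_flip: "planar_quad a b c d \<Longrightarrow> planar_quad b a d c"
  unfolding planar_quad_def nondegenerate_quad_def by (simp add: insert_commute)

lemma not_on_line_distinct:
  fixes a b c :: "'a::euclidean_space pspace"
  assumes "DIM('a) \<ge> 2" "\<not> on_line {a, b, c}"
  shows "a \<noteq> b"
proof
  assume "a = b"
  obtain A where A: "A \<noteq> 0" "a = pt A" by (rule pt_cases)
  obtain C where C: "C \<noteq> 0" "c = pt C" by (rule pt_cases)
  have "on_line {pt A, pt A, pt C} \<or> on_line {pt A, pt C, pt A}"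
    using on_line_pt[of A C A] A C assms(1) by (simp add: span_base)
  thus False using assms(2) A C \<open>a = b\<close> by (simp add: insert_commute)
qed

lemma planar_quad_coordinates:
  fixes X X1 X2 X12 :: "'a::euclidean_space"
  assumes "DIM('a) \<ge> 2" "X \<noteq> 0" "X1 \<noteq> 0" "X2 \<noteq> 0" "X12 \<noteq> 0"
    and q: "planar_quad (pt X) (pt X1) (pt X12) (pt X2)"
  shows "pt X \<noteq> pt X1" "pt X \<noteq> pt X2" "pt X1 \<noteq> pt X12" "pt X2 \<noteq> pt X12"
    "X12 \<in> span {X, X1, X2}" "X1 \<in> span {X, X2, X12}"
    "X12 \<notin> span {X1, X2}" "X1 \<notin> span {X2, X12}" "X2 \<notin> span {X1, X12}" "X2 \<notin> span {X12}"
proof -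
  have pl: "on_plane {pt X, pt X1, pt X12, pt X2}"
    and nl: "\<not> on_line {pt X, pt X1, pt X12}" "\<not> on_line {pt X, pt X1, pt X2}"
     "\<not> on_line {pt X, pt X12, pt X2}" "\<not> on_line {pt X1, pt X12, pt X2}"
    using q unfolding planar_quad_def nondegenerate_quad_def by auto
  note dist = not_on_line_distinct[OF assms(1)]
  show "pt X \<noteq> pt X1" "pt X1 \<noteq> pt X12" using dist nl by blast+
  show "pt X \<noteq> pt X2" using dist[of "pt X" "pt X2" "pt X1"] nl(2) by (simp add: insert_commute)
  show ne: "pt X2 \<noteq> pt X12" using dist[of "pt X2" "pt X12" "pt X"] nl(3) by (simp add: insert_commute)
  have "on_plane {pt X, pt X1, pt X2, pt X12}" "on_plane {pt X, pt X2, pt X12, pt X1}"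
    "\<not> on_line {pt X, pt X2, pt X12}"
    using pl nl by (simp_all add: insert_commute)
  thus "X12 \<in> span {X, X1, X2}" "X1 \<in> span {X, X2, X12}"
    using on_plane_imp_span assms(1-5) nl(2) by metis+
  have "\<not> on_line {pt X1, pt X2, pt X12}" "\<not> on_line {pt X2, pt X12, pt X1}"
    using nl(4) by (simp_all add: insert_commute)
  thus "X12 \<notin> span {X1, X2}" "X1 \<notin> span {X2, X12}" "X2 \<notin> span {X1, X12}"
    using on_line_pt[of X1 X2 X12] on_line_pt[of X2 X12 X1] on_line_pt[of X1 X12 X2] assms(1-5) nl(4)
    by blast+
  show "X2 \<notin> span {X12}" using ne pt_eq_iff[of X12 X2] assms by auto
qed

lemma propagates_lift:
  fixes X X1 X2 X12 :: "'a::euclidean_space"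
  assumes dim: "DIM('a) \<ge> 4"
    and nz: "X \<noteq> 0" "X1 \<noteq> 0" "X2 \<noteq> 0" "X12 \<noteq> 0"
    and q: "planar_quad (pt X) (pt X1) (pt X12) (pt X2)"
    and A: "edge_refl X X1 A1" "edge_refl X X2 A2"
    and propag: "propagates (pt X) (pt X1) (pt X12) (pt X2) (pmap A1) (pmap A2) h1 h2"
  obtains B1 B2 where "edge_refl X2 X12 B1" "edge_refl X1 X12 B2" "h1 = pmap B1" "h2 = pmap B2"
    "\<And>v. B2 (A1 v) - B1 (A2 v) \<in> span {X12}"
proof -
  have d2: "DIM('a) \<ge> 2" using dim by simp
  note qc = planar_quad_coordinates[OF d2 nz q]
  have h: "h1 \<in> F_opi" "h2 \<in> F_opi" "h1 (pt X2) = pt X12" "h2 (pt X1) = pt X12"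
    using propag unfolding propagates_def by auto
  obtain B1 where B1: "edge_refl X2 X12 B1" "h1 = pmap B1"
    using F_opi_edge_refl[OF d2 h(1) nz(3,4) h(3) qc(4)] by blast
  obtain B2 where B2: "edge_refl X1 X12 B2" "h2 = pmap B2"
    using F_opi_edge_refl[OF d2 h(2) nz(2,4) h(4) qc(3)] by blast
  show ?thesis
    using that B1 B2 propagates_iff[OF dim nz A B1(1) B2(1) qc(5)] propag by blast
qed

lemma propagates_unique:
  fixes x :: "'a::euclidean_space pspace"
  assumes dim: "DIM('a) \<ge> 4" and q: "planar_quad x x1 x12 x2"
    and f: "f1 \<in> F_opi" "f2 \<in> F_opi" "f1 x = x1" "f2 x = x2"
    and h: "propagates x x1 x12 x2 f1 f2 h1 h2"
    and g: "propagates x x1 x12 x2 f1 f2 g1 g2"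
  shows "h1 = g1 \<and> h2 = g2"
proof -
  have d2: "DIM('a) \<ge> 2" using dim by simp
  obtain X where X: "X \<noteq> 0" "x = pt X" by (rule pt_cases)
  obtain X1 where X1: "X1 \<noteq> 0" "x1 = pt X1" by (rule pt_cases)
  obtain X2 where X2: "X2 \<noteq> 0" "x2 = pt X2" by (rule pt_cases)
  obtain X12 where X12: "X12 \<noteq> 0" "x12 = pt X12" by (rule pt_cases)
  note nz = X(1) X1(1) X2(1) X12(1)
  note eqs = X(2) X1(2) X2(2) X12(2)
  have q': "planar_quad (pt X) (pt X1) (pt X12) (pt X2)" using q eqs by simp
  note qc = planar_quad_coordinates[OF d2 nz q']
  obtain A1 where A1: "edge_refl X X1 A1" "f1 = pmap A1"
    using F_opi_edge_refl[OF d2 f(1) nz(1,2) _ qc(1)] f(3) eqs by metis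
  obtain A2 where A2: "edge_refl X X2 A2" "f2 = pmap A2"
    using F_opi_edge_refl[OF d2 f(2) nz(1,3) _ qc(2)] f(4) eqs by metis
  obtain B1 B2 where B: "edge_refl X2 X12 B1" "edge_refl X1 X12 B2" "h1 = pmap B1" "h2 = pmap B2"
    "\<And>v. B2 (A1 v) - B1 (A2 v) \<in> span {X12}"
    using propagates_lift[OF dim nz q' A1(1) A2(1), of h1 h2] h eqs A1 A2 by blast
  obtain C1 C2 where C: "edge_refl X2 X12 C1" "edge_refl X1 X12 C2" "g1 = pmap C1" "g2 = pmap C2"
    "\<And>v. C2 (A1 v) - C1 (A2 v) \<in> span {X12}"
    using propagates_lift[OF dim nz q' A1(1) A2(1), of g1 g2] g eqs A1 A2 by blast
  have "B2 = C2"
    by (rule congruence_determines_reflection[OF edge_refl_involution[OF A1(1)]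
          B(2) C(2) B(1) C(1) B(5) C(5) qc(8)])
  moreover have "B1 (A2 v) - B2 (A1 v) \<in> span {X12}" "C1 (A2 v) - C2 (A1 v) \<in> span {X12}" for v
    using span_neg[OF B(5)[of v]] span_neg[OF C(5)[of v]] by simp_all
  hence "B1 = C1"
    using congruence_determines_reflection[OF edge_refl_involution[OF A2(1)]
          B(1) C(1) B(2) C(2) _ _ qc(9)] by blast
  ultimately show ?thesis using B C by simp
qed

lemma propagates_exists:
  fixes x :: "'a::euclidean_space pspace"
  assumes dim: "DIM('a) \<ge> 4" and q: "planar_quad x x1 x12 x2"
    and f: "f1 \<in> F_opi" "f2 \<in> F_opi" "f1 x = x1" "f2 x = x2"
    and gen: "generic_reflections x x12 f1 f2"
  shows "\<exists>h1 h2. propagates x x1 x12 x2 f1 f2 h1 h2"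
proof -
  have d2: "DIM('a) \<ge> 2" using dim by simp
  obtain X where X: "X \<noteq> 0" "x = pt X" by (rule pt_cases)
  obtain X1 where X1: "X1 \<noteq> 0" "x1 = pt X1" by (rule pt_cases)
  obtain X2 where X2: "X2 \<noteq> 0" "x2 = pt X2" by (rule pt_cases)
  obtain X12 where X12: "X12 \<noteq> 0" "x12 = pt X12" by (rule pt_cases)
  note nz = X(1) X1(1) X2(1) X12(1)
  note eqs = X(2) X1(2) X2(2) X12(2)
  have q': "planar_quad (pt X) (pt X1) (pt X12) (pt X2)" using q eqs by simp
  note qc = planar_quad_coordinates[OF d2 nz q']
  obtain A1 where A1: "edge_refl X X1 A1" "f1 = pmap A1"
    using F_opi_edge_refl[OF d2 f(1) nz(1,2) _ qc(1)] f(3) eqs by metis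
  obtain A2 where A2: "edge_refl X X2 A2" "f2 = pmap A2"
    using F_opi_edge_refl[OF d2 f(2) nz(1,3) _ qc(2)] f(4) eqs by metis
  have nzA: "A1 X12 \<noteq> 0" "A2 X12 \<noteq> 0"
    using edge_refl_involution[OF A1(1), of X12] edge_refl_involution[OF A2(1), of X12] nz(4)
      linear_0[OF edge_refl_linear[OF A1(1)]] linear_0[OF edge_refl_linear[OF A2(1)]] by auto
  have "\<not> on_line {pt X, pt (A1 X12), pt (A2 X12)}"
    using gen nz eqs A1 A2 unfolding generic_reflections_def
    by (simp add: pmap_pt edge_refl_linear)
  moreover have "{pt X, pt (A1 X12), pt (A2 X12)} = {pt X, pt (A2 X12), pt (A1 X12)}" by auto
  ultimately have "A2 X12 \<notin> span {X, A1 X12}" "A1 X12 \<notin> span {X, A2 X12}"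
    using on_line_pt[OF nz(1) nzA _ d2] on_line_pt[OF nz(1) nzA(2,1) _ d2] by auto
  then obtain B1 B2 where B: "edge_refl X2 X12 B1" "edge_refl X1 X12 B2"
    "\<And>v. B2 (A1 v) - B1 (A2 v) \<in> span {X12}"
    using congruence_solvable[OF A1(1) A2(1) qc(5) qc(7)] by blast
  hence "propagates x x1 x12 x2 f1 f2 (pmap B1) (pmap B2)"
    using propagates_iff[OF dim nz A1(1) A2(1) B(1) B(2) qc(5)] eqs A1 A2 by simp
  thus ?thesis by blast
qed

lemma propagates_swap:
  "propagates x x1 x12 x2 f1 f2 h1 h2 \<Longrightarrow> propagates x x2 x12 x1 f2 f1 h2 h1"
  unfolding propagates_def by auto

lemma F_opi_line:
  fixes f :: "'a::euclidean_space pspace \<Rightarrow> 'a pspace"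
  assumes "DIM('a) \<ge> 2" "f \<in> F_opi" "is_line l"
  shows "is_line (f ` l)"
proof -
  obtain n c where nc: "n \<bullet> c = 2" "f = pmap (refl_map n c)"
    using assms F_opi_iff by blast
  have lin: "linear (refl_map n c)" by (rule linear_refl_map)
  have inj: "inj (refl_map n c)" by (metis refl_map_involution[OF nc(1)] injI)
  obtain W where W: "subspace W" "dim W = 2" "l = points_in W"
    using assms(3) unfolding is_line_def is_flat_def by auto
  have "dim (refl_map n c ` W) = 2"
    using W dim_image_eq[OF lin, of W] inj by (simp add: inj_on_subset)
  moreover have "f ` l = points_in (refl_map n c ` W)"
    using pmap_points_in[OF lin inj W(1)] W nc by simp
  ultimately show ?thesis unfolding is_line_def is_flat_def
    using linear_subspace_image[OF lin W(1)] by auto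
qed

text \<open>Lines through \<open>x1\<close> are the images under \<open>f1\<close> of lines through \<open>x\<close>. As
  reflections are involutions, the pencil condition at \<open>x\<close> can be solved for the
  reflections at \<open>x1\<close>. Together with the exchange of the two directions this generates all
  symmetries of the quadrilateral.\<close>

lemma propagates_flip:
  fixes x :: "'a::euclidean_space pspace"
  assumes d2: "DIM('a) \<ge> 2"
    and f: "f1 \<in> F_opi" "f2 \<in> F_opi" "f1 x = x1" "f2 x = x2"
    and propag: "propagates x x1 x12 x2 f1 f2 h1 h2"
  shows "propagates x1 x x2 x12 f1 h2 h1 f2"
proof -
  have h: "h1 \<in> F_opi" "h1 x2 = x12"
    and lines: "\<And>l. is_line l \<Longrightarrow> x \<in> l \<Longrightarrow> (h2 \<circ> f1) ` l = (h1 \<circ> f2) ` l"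
    using propag unfolding propagates_def by auto
  note inv = F_opi_involution[OF d2]
  have "(f2 \<circ> f1) ` l = (h1 \<circ> h2) ` l" if l: "is_line l" "x1 \<in> l" for l
  proof -
    have "x \<in> f1 ` l" using l(2) f inv[OF f(1), of x] by force
    hence "(h2 \<circ> f1) ` (f1 ` l) = (h1 \<circ> f2) ` (f1 ` l)"
      using lines F_opi_line[OF d2 f(1) l(1)] by blast
    hence e: "(\<lambda>p. h2 (f1 (f1 p))) ` l = (\<lambda>p. h1 (f2 (f1 p))) ` l" by (simp add: image_image)
    have "h1 ` ((\<lambda>p. h2 (f1 (f1 p))) ` l) = h1 ` ((\<lambda>p. h1 (f2 (f1 p))) ` l)" by (simp only: e)
    thus ?thesis by (simp add: image_image inv[OF f(1)] inv[OF h(1)])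
  qed
  thus ?thesis unfolding propagates_def using f h inv[OF h(1), of x2] by auto
qed

text \<open>Three faces at \<open>x\<close> and one at \<open>x1\<close> already assign \<open>g3\<close> to the edge from
  \<open>x12\<close> to \<open>x123\<close>. The face at \<open>x2\<close> shares that edge, and the conclusion says
  that propagation across it is compatible with \<open>g3\<close>.\<close>

lemma cube_propagation:
  fixes x :: "'a::euclidean_space pspace"
  assumes dim: "DIM('a) \<ge> 4"
    and q12: "planar_quad x x1 x12 x2" and q13: "planar_quad x x1 x13 x3"
    and q23: "planar_quad x x2 x23 x3"
    and q1: "planar_quad x1 x12 x123 x13" and q2: "planar_quad x2 x12 x123 x23"
    and q3: "planar_quad x3 x13 x123 x23"
    and spatial: "\<not> on_plane {x23, x2, x3, x123}"
    and f: "f1 \<in> F_opi" "f2 \<in> F_opi" "f3 \<in> F_opi" "f1 x = x1" "f2 x = x2" "f3 x = x3"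
    and p12: "propagates x x1 x12 x2 f1 f2 f12 f21"
    and p13: "propagates x x1 x13 x3 f1 f3 f13 f31"
    and p23: "propagates x x2 x23 x3 f2 f3 f23 f32"
    and p1: "propagates x1 x12 x123 x13 f21 f31 g2 g3"
  shows "\<exists>g1. propagates x2 x12 x123 x23 f12 f32 g1 g3"
proof -
  have d2: "DIM('a) \<ge> 2" "DIM('a) \<ge> 3" using dim by simp_all
  obtain X where X: "X \<noteq> 0" "x = pt X" by (rule pt_cases)
  obtain X1 where X1: "X1 \<noteq> 0" "x1 = pt X1" by (rule pt_cases)
  obtain X2 where X2: "X2 \<noteq> 0" "x2 = pt X2" by (rule pt_cases)
  obtain X3 where X3: "X3 \<noteq> 0" "x3 = pt X3" by (rule pt_cases)
  obtain X12 where X12: "X12 \<noteq> 0" "x12 = pt X12" by (rule pt_cases)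
  obtain X13 where X13: "X13 \<noteq> 0" "x13 = pt X13" by (rule pt_cases)
  obtain X23 where X23: "X23 \<noteq> 0" "x23 = pt X23" by (rule pt_cases)
  obtain X123 where X123: "X123 \<noteq> 0" "x123 = pt X123" by (rule pt_cases)
  note eqs = X(2) X1(2) X2(2) X3(2) X12(2) X13(2) X23(2) X123(2)
  note nz = X(1) X1(1) X2(1) X3(1) X12(1) X13(1) X23(1) X123(1)
  note coords = planar_quad_coordinates[OF d2(1)]
  note c12 = coords[OF nz(1,2,3,5) q12[unfolded eqs]]
  note c13 = coords[OF nz(1,2,4,6) q13[unfolded eqs]]
  note c2 = coords[OF nz(3,5,7,8) q2[unfolded eqs]]
  note c3 = coords[OF nz(4,6,7,8) q3[unfolded eqs]]
  obtain A1 where A1: "edge_refl X X1 A1" "f1 = pmap A1"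
    using F_opi_edge_refl[OF d2(1) f(1) nz(1,2) _ c12(1)] f(4) eqs by metis
  obtain A2 where A2: "edge_refl X X2 A2" "f2 = pmap A2"
    using F_opi_edge_refl[OF d2(1) f(2) nz(1,3) _ c12(2)] f(5) eqs by metis
  obtain A3 where A3: "edge_refl X X3 A3" "f3 = pmap A3"
    using F_opi_edge_refl[OF d2(1) f(3) nz(1,4) _ c13(2)] f(6) eqs by metis
  obtain A12 A21 where A12: "edge_refl X2 X12 A12" "edge_refl X1 X12 A21" "f12 = pmap A12" "f21 = pmap A21"
    "\<And>v. A21 (A1 v) - A12 (A2 v) \<in> span {X12}"
    using propagates_lift[OF dim nz(1,2,3,5) q12[unfolded eqs] A1(1) A2(1), of f12 f21]
      p12 eqs A1 A2 by blast
  obtain A13 A31 where A13: "edge_refl X3 X13 A13" "edge_refl X1 X13 A31" "f13 = pmap A13" "f31 = pmap A31"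
    "\<And>v. A31 (A1 v) - A13 (A3 v) \<in> span {X13}"
    using propagates_lift[OF dim nz(1,2,4,6) q13[unfolded eqs] A1(1) A3(1), of f13 f31]
      p13 eqs A1 A3 by blast
  obtain A23 A32 where A23: "edge_refl X3 X23 A23" "edge_refl X2 X23 A32" "f23 = pmap A23" "f32 = pmap A32"
    "\<And>v. A32 (A2 v) - A23 (A3 v) \<in> span {X23}"
    using propagates_lift[OF dim nz(1,3,4,7) q23[unfolded eqs] A2(1) A3(1), of f23 f32]
      p23 eqs A2 A3 by blast
  obtain C2 C3 where C: "edge_refl X13 X123 C2" "edge_refl X12 X123 C3" "g2 = pmap C2" "g3 = pmap C3"
    "\<And>v. C3 (A21 v) - C2 (A31 v) \<in> span {X123}"
    using propagates_lift[OF dim nz(2,5,6,8) q1[unfolded eqs] A12(2) A13(2), of g2 g3]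
      p1 eqs A12 A13 by blast
  have indep: "X2 \<notin> span {X3, X23, X123}"
  proof
    assume "X2 \<in> span {X3, X23, X123}"
    hence "on_plane {pt X3, pt X23, pt X123, pt X2}" using on_plane_pt nz d2 by blast
    moreover have "{pt X3, pt X23, pt X123, pt X2} = {x23, x2, x3, x123}" using eqs by auto
    ultimately show False using spatial by simp
  qed
  obtain C1 where C1: "edge_refl X23 X123 C1" "\<And>v. C3 (A12 v) - C1 (A32 v) \<in> span {X123}"
    using cube_closes[OF A1(1) A2(1) A3(1) A12(1,2) A13(1,2) A23(1,2) C(1,2)
        A12(5) A13(5) A23(5) C(5) nz(8) c2(6) c3(6) c2(10) indep] by blast
  hence "propagates x2 x12 x123 x23 f12 f32 (pmap C1) g3"
    using propagates_iff[OF dim nz(3,5,7,8) A12(1) A23(2) C1(1) C(2) c2(5)] eqs A12 A23 C by simp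
  thus ?thesis by blast
qed

section \<open>Signed edges, quadrilaterals and cubes of the lattice\<close>

lemma axis_neg_cancel [simp]:
  fixes z :: "int ^ 'm::finite"
  shows "z + axis i s + axis i (-s) = z" "z + axis i (-s) + axis i s = z"
  by (simp_all add: vec_eq_iff axis_def)

lemma axis_minus_one: "axis i (-1) = - unit_step i"
  by (simp add: vec_eq_iff axis_def)

lemma sign_cases:
  assumes "\<bar>s::int\<bar> = 1"
  obtains "s = 1" | "s = -1"
  using assms by linarith

lemma generic_Q_net_planar_quad:
  fixes x :: "int ^ 'm::finite \<Rightarrow> 'a::euclidean_space pspace"
  assumes g: "generic_Q_net x" and ij: "i \<noteq> j" and st: "\<bar>s\<bar> = 1" "\<bar>t\<bar> = 1"
  shows "planar_quad (x z) (x (z + axis i s)) (x (z + axis i s + axis j t)) (x (z + axis j t))"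
proof -
  let ?P = "\<lambda>z i s j t.
    planar_quad (x z) (x (z + axis i s)) (x (z + axis i s + axis j t)) (x (z + axis j t))"
  have base: "?P z i 1 j 1" if "i \<noteq> j" for z i j
    using g that unfolding generic_Q_net_def Q_net_def planar_quad_def by blast
  have swap: "?P z j t i s" if "?P z i s j t" for z i s j t
    using planar_quad_swap[OF that] by (simp add: add_ac)
  have turn: "?P z i (-s) j t" if "?P (z + axis i (-s)) i s j t" for z i s j t
    using planar_quad_flip[OF that] by simp
  have 1: "?P z i s j 1" if "i \<noteq> j" "\<bar>s\<bar> = 1" for z i s j
    using that(2)
  proof (cases rule: sign_cases)
    case 2
    thus ?thesis using turn[OF base[OF that(1)], of z] by simp
  qed (use base that in simp)
  show ?thesis using st(2)
  proof (cases rule: sign_cases)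
    case 2
    thus ?thesis using swap[OF turn[OF swap[OF 1[OF ij st(1)]], of z]] by simp
  qed (use 1 ij st in simp)
qed

text \<open>Two faces of a cube share the edge from \<open>a\<close> to \<open>b\<close>. If the three edges at
  \<open>a\<close> are coplanar, both faces lie in their plane, so the three edges at \<open>b\<close> are
  coplanar as well.\<close>

lemma opposite_corner_plane:
  fixes a :: "'a::euclidean_space pspace"
  assumes d2: "DIM('a) \<ge> 2" and q: "planar_quad a b c d" "planar_quad a b e f"
    and pl: "on_plane {a, b, d, f}"
  shows "on_plane {b, a, c, e}"
proof -
  obtain A where A: "A \<noteq> 0" "a = pt A" by (rule pt_cases)
  obtain B where B: "B \<noteq> 0" "b = pt B" by (rule pt_cases)
  obtain C where C: "C \<noteq> 0" "c = pt C" by (rule pt_cases)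
  obtain D where D: "D \<noteq> 0" "d = pt D" by (rule pt_cases)
  obtain E where E: "E \<noteq> 0" "e = pt E" by (rule pt_cases)
  obtain F where F: "F \<noteq> 0" "f = pt F" by (rule pt_cases)
  have CE: "C \<in> span {A, B, D}" "E \<in> span {A, B, F}"
    using planar_quad_coordinates(5)[OF d2] q A B C D E F by blast+
  obtain W where W: "subspace W" "dim W = 3" "{a, b, d, f} \<subseteq> points_in W"
    using pl unfolding on_plane_def is_plane_def is_flat_def by auto
  hence m: "A \<in> W" "B \<in> W" "D \<in> W" "F \<in> W" using A B D F by (auto simp: pt_in_points_in)
  hence "C \<in> W" "E \<in> W"
    using CE span_minimal[of "{A, B, D}" W] span_minimal[of "{A, B, F}" W] W by auto
  thus ?thesis using m W A B C E by (intro on_plane_I[of W]) (auto simp: pt_in_points_in)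
qed

text \<open>Genericity of the net is formulated for corners with all three edges in positive direction;
  moving along the edges of the cube one after the other transfers it to any corner.\<close>

lemma generic_Q_net_spatial:
  fixes x :: "int ^ 'm::finite \<Rightarrow> 'a::euclidean_space pspace"
  assumes d2: "DIM('a) \<ge> 2" and g: "generic_Q_net x"
    and ijk: "i \<noteq> j" "i \<noteq> k" "j \<noteq> k" and stu: "\<bar>s\<bar> = 1" "\<bar>t\<bar> = 1" "\<bar>u\<bar> = 1"
  shows "\<not> on_plane {x z, x (z + axis i s), x (z + axis j t), x (z + axis k u)}"
proof -
  let ?P = "\<lambda>z i s j t k u. \<not> on_plane {x z, x (z + axis i s), x (z + axis j t), x (z + axis k u)}"
  have base: "?P z i 1 j 1 k 1" if "i \<noteq> j" "i \<noteq> k" "j \<noteq> k" for z i j k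
    using g that unfolding generic_Q_net_def by blast
  have turn: "?P z i (-s) j t k u"
    if P: "?P (z + axis i (-s)) i s j t k u" and ne: "i \<noteq> j" "i \<noteq> k"
      and sg: "\<bar>s\<bar> = 1" "\<bar>t\<bar> = 1" "\<bar>u\<bar> = 1" for z i s j t k u
  proof
    assume "on_plane {x z, x (z + axis i (-s)), x (z + axis j t), x (z + axis k u)}"
    moreover have "\<bar>-s\<bar> = 1" using sg by simp
    ultimately have "on_plane {x (z + axis i (-s)), x z,
        x (z + axis i (-s) + axis j t), x (z + axis i (-s) + axis k u)}"
      using opposite_corner_plane[OF d2] generic_Q_net_planar_quad[OF g] ne sg by blast
    thus False using P by simp
  qed
  have 1: "?P z i s j 1 k 1" if "i \<noteq> j" "i \<noteq> k" "j \<noteq> k" "\<bar>s\<bar> = 1" for z i s j k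
    using that(4)
  proof (cases rule: sign_cases)
    case 2
    have "?P (z + axis i (-1)) i 1 j 1 k 1" by (rule base[OF that(1-3)])
    from turn[OF this that(1,2)] show ?thesis using 2 by simp
  qed (use base that in simp)
  have swap: "?P z j t i s k u" if "?P z i s j t k u" for z i s j t k u
    using that by (simp add: insert_commute)
  have cycle: "?P z k u i s j t" if "?P z i s j t k u" for z i s j t k u
    using that by (simp add: insert_commute)
  have two: "?P z i s j t k 1" if "i \<noteq> j" "i \<noteq> k" "j \<noteq> k" "\<bar>s\<bar> = 1" "\<bar>t\<bar> = 1" for z i s j t k
    using that(5)
  proof (cases rule: sign_cases)
    case 2
    have "?P (z + axis j (-1)) j 1 i s k 1" by (rule swap[OF 1[OF that(1-4)]])
    from swap[OF turn[OF this]] show ?thesis using that 2 by simp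
  qed (use 1 that in simp)
  show ?thesis using stu(3)
  proof (cases rule: sign_cases)
    case 2
    have "?P (z + axis k (-1)) k 1 i s j t" by (rule cycle[OF two[OF ijk stu(1,2)]])
    from cycle[OF cycle[OF turn[OF this]]] show ?thesis using ijk stu 2 by simp
  qed (use two ijk stu in simp)
qed

section \<open>Propagation away from the origin\<close>

text \<open>The distance of \<open>z\<close> from the origin in the lattice graph.\<close>

definition level :: "int ^ 'm::finite \<Rightarrow> nat" where
  "level z = (\<Sum>k\<in>UNIV. nat \<bar>z $ k\<bar>)"

lemma level_step:
  fixes z :: "int ^ 'm::finite"
  assumes "\<bar>s\<bar> = 1" "0 \<le> s * z $ i"
  shows "level (z + axis i s) = Suc (level z)"
proof -
  have "nat \<bar>(z + axis i s) $ i\<bar> = Suc (nat \<bar>z $ i\<bar>)"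
    using assms by (elim sign_cases) (auto simp: axis_def)
  moreover have "(\<Sum>k\<in>UNIV - {i}. nat \<bar>(z + axis i s) $ k\<bar>) = (\<Sum>k\<in>UNIV - {i}. nat \<bar>z $ k\<bar>)"
    by (intro sum.cong) (auto simp: axis_def)
  ultimately show ?thesis unfolding level_def by (simp add: sum.remove[of UNIV i])
qed

text \<open>The reflections assigned to the edges from \<open>z\<close> to \<open>z + axis i s\<close> that lead away
  from the origin, starting from the Cauchy data and using only propagation across quadrilaterals oriented away from the origin. Each
  step raises the level of the starting vertex by one, so that properties of the assignment can be
  proved by induction on the level.\<close>

inductive outward ::
  "(int ^ 'm::finite \<Rightarrow> 'a::euclidean_space pspace) \<Rightarrow>
   ('m \<Rightarrow> int ^ 'm \<Rightarrow> 'a pspace \<Rightarrow> 'a pspace) \<Rightarrow>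
   int ^ 'm \<Rightarrow> 'm \<Rightarrow> int \<Rightarrow> ('a pspace \<Rightarrow> 'a pspace) \<Rightarrow> bool"
  for x g where
  pos: "z \<in> coordinate_axis i \<Longrightarrow> 0 \<le> z $ i \<Longrightarrow> outward x g z i 1 (g i z)"
| neg: "z \<in> coordinate_axis i \<Longrightarrow> z $ i \<le> 0 \<Longrightarrow> outward x g z i (-1) (g i (z - unit_step i))"
| step: "i \<noteq> j \<Longrightarrow> outward x g z i s f1 \<Longrightarrow> outward x g z j t f2 \<Longrightarrow>
    propagates (x z) (x (z + axis i s)) (x (z + axis i s + axis j t)) (x (z + axis j t)) f1 f2 h1 h2
    \<Longrightarrow> outward x g (z + axis j t) i s h1"

lemma outward_sign: "outward x g z i s f \<Longrightarrow> \<bar>s\<bar> = 1 \<and> 0 \<le> s * z $ i"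
  by (induction rule: outward.induct) (auto simp: axis_def)

lemma coordinate_axis_iff: "z \<in> coordinate_axis i \<longleftrightarrow> (\<forall>j. j \<noteq> i \<longrightarrow> z $ j = 0)"
proof
  assume "\<forall>j. j \<noteq> i \<longrightarrow> z $ j = 0"
  hence "z = axis i (z $ i)" by (simp add: vec_eq_iff axis_def)
  thus "z \<in> coordinate_axis i" unfolding coordinate_axis_def by blast
qed (auto simp: coordinate_axis_def axis_def)

lemma coordinate_axis_pred: "z \<in> coordinate_axis i \<Longrightarrow> z - unit_step i \<in> coordinate_axis i"
  by (simp add: coordinate_axis_iff axis_def)

lemma outward_edge:
  fixes x :: "int ^ 'm::finite \<Rightarrow> 'a::euclidean_space pspace"
  assumes d2: "DIM('a) \<ge> 2" and c: "cauchy_data x g"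
  shows "outward x g z i s f \<Longrightarrow> f \<in> F_opi \<and> f (x z) = x (z + axis i s)"
proof (induction rule: outward.induct)
  case (pos z i)
  thus ?case using c unfolding cauchy_data_def by blast
next
  case (neg z i)
  let ?w = "z - unit_step i"
  have "g i ?w \<in> F_opi" "g i ?w (x ?w) = x z"
    using c coordinate_axis_pred[OF neg(1)] unfolding cauchy_data_def by force+
  thus ?case using F_opi_involution[OF d2, of "g i ?w" "x ?w"] by (simp add: axis_minus_one)
next
  case (step i j z s f1 t f2 h1 h2)
  thus ?case unfolding propagates_def by (simp add: add_ac)
qed

lemma outward_reached: "outward x g z i s f \<Longrightarrow> reached x g z (z + axis i s) f"
proof (induction rule: outward.induct)
  case (pos z i)
  thus ?case by (simp add: reached.initial)
next
  case (neg z i)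
  have "reached x g (z - unit_step i) (z - unit_step i + unit_step i) (g i (z - unit_step i))"
    by (rule reached.initial[OF coordinate_axis_pred[OF neg(1)]])
  thus ?case using reached.reverse by (simp add: axis_minus_one)
next
  case (step i j z s f1 t f2 h1 h2)
  have "lattice_quad z (z + axis i s) (z + axis i s + axis j t) (z + axis j t)"
    unfolding lattice_quad_def using step(1) outward_sign[OF step(2)] outward_sign[OF step(3)] by blast
  from reached.step[OF this step.IH step(4)] show ?case by (simp add: add_ac)
qed

context
  fixes x :: "int ^ 'm::finite \<Rightarrow> 'a::euclidean_space pspace"
    and g :: "'m \<Rightarrow> int ^ 'm \<Rightarrow> 'a pspace \<Rightarrow> 'a pspace"
  assumes dim: "DIM('a) \<ge> 4" and net: "generic_Q_net x" and cauchy: "generic_cauchy_data x g"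
begin

lemma dim2: "DIM('a) \<ge> 2"
  using dim by simp

lemma outward_F_opi: "outward x g z i s f \<Longrightarrow> f \<in> F_opi"
  and outward_maps: "outward x g z i s f \<Longrightarrow> f (x z) = x (z + axis i s)"
  using outward_edge[OF dim2] cauchy unfolding generic_cauchy_data_def by blast+

lemma outward_quad:
  assumes "i \<noteq> j" "outward x g z i s f1" "outward x g z j t f2"
  obtains h1 h2 where
    "propagates (x z) (x (z + axis i s)) (x (z + axis i s + axis j t)) (x (z + axis j t)) f1 f2 h1 h2"
    "outward x g (z + axis j t) i s h1" "outward x g (z + axis i s) j t h2"
proof -
  have st: "\<bar>s\<bar> = 1" "\<bar>t\<bar> = 1" using outward_sign assms by blast+
  hence "lattice_quad z (z + axis i s) (z + axis i s + axis j t) (z + axis j t)"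
    unfolding lattice_quad_def using assms(1) by blast
  hence "generic_reflections (x z) (x (z + axis i s + axis j t)) f1 f2"
    using cauchy outward_reached assms(2,3) unfolding generic_cauchy_data_def by blast
  then obtain h1 h2 where h:
    "propagates (x z) (x (z + axis i s)) (x (z + axis i s + axis j t)) (x (z + axis j t)) f1 f2 h1 h2"
    using propagates_exists[OF dim generic_Q_net_planar_quad[OF net assms(1) st]]
      outward_F_opi outward_maps assms by blast
  have h': "propagates (x z) (x (z + axis j t)) (x (z + axis j t + axis i s)) (x (z + axis i s)) f2 f1 h2 h1"
    using propagates_swap[OF h] by (simp add: add_ac)
  show ?thesis
    using that[OF h outward.step[OF assms h] outward.step[OF assms(1)[symmetric] assms(3,2) h']] .
qed

lemma inward_neighbour:
  fixes z :: "int ^ 'm"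
  assumes "z $ j \<noteq> 0"
  obtains y t where "z = y + axis j t" "\<bar>t\<bar> = 1" "0 \<le> t * y $ j" "level z = Suc (level y)"
proof -
  define t where "t = sgn (z $ j)"
  define y where "y = z - axis j t"
  have t: "\<bar>t\<bar> = 1" and y: "0 \<le> t * y $ j"
    using assms by (auto simp: t_def y_def axis_def sgn_if)
  have z: "z = y + axis j t" by (simp add: y_def)
  show ?thesis using that[OF z t y] level_step[OF t y] z by simp
qed

text \<open>An edge in direction \<open>i\<close> off the axis has a nonzero coordinate \<open>j \<noteq> i\<close> at its
  start. The quadrilateral towards the origin in direction \<open>j\<close> has its two inner edges one
  level lower.\<close>

lemma outward_exists:
  "\<bar>s\<bar> = 1 \<Longrightarrow> 0 \<le> s * z $ i \<Longrightarrow> \<exists>f. outward x g z i s f"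
proof (induction "level z" arbitrary: z i s rule: less_induct)
  case less
  show ?case
  proof (cases "z \<in> coordinate_axis i")
    case True
    show ?thesis using less.prems(1)
    proof (cases rule: sign_cases)
      case 1
      thus ?thesis using outward.pos[OF True] less.prems by auto
    next
      case 2
      thus ?thesis using outward.neg[OF True] less.prems by auto
    qed
  next
    case False
    then obtain j where j: "j \<noteq> i" "z $ j \<noteq> 0" by (auto simp: coordinate_axis_iff)
    obtain y t where y: "z = y + axis j t" "\<bar>t\<bar> = 1" "0 \<le> t * y $ j" "level z = Suc (level y)"
      using inward_neighbour[OF j(2)] by blast
    have "y $ i = z $ i" using j y(1) by (simp add: axis_def)
    then obtain f1 f2 where "outward x g y i s f1" "outward x g y j t f2"
      using less.hyps[of y s i] less.hyps[of y t j] less.prems y by auto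
    thus ?thesis using outward_quad[of i j y s f1 t f2] j(1) y(1) by metis
  qed
qed

text \<open>In the second case the quadrilateral is determined by the direction \<open>j\<close> alone, since the
  sign \<open>t\<close> is that of the coordinate \<open>w $ j\<close>.\<close>

lemma outward_inversion:
  assumes "outward x g w i s f"
  obtains
    "w \<in> coordinate_axis i" "f = g i (if s = 1 then w else w - unit_step i)"
  | j z t f1 f2 h2 where "i \<noteq> j" "w = z + axis j t" "w $ j \<noteq> 0" "t = sgn (w $ j)"
      "outward x g z i s f1" "outward x g z j t f2"
      "propagates (x z) (x (z + axis i s)) (x (z + axis i s + axis j t)) (x (z + axis j t)) f1 f2 f h2"
  using assms
proof cases
  case pos
  thus ?thesis using that(1) by simp
next
  case neg
  thus ?thesis using that(1) by simp
next
  case (step j z f1 t f2 h2)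
  have "\<bar>t\<bar> = 1" "0 \<le> t * z $ j" using outward_sign[OF step(4)] by auto
  hence "w $ j \<noteq> 0" "t = sgn (w $ j)"
    using step(1) by (auto simp: axis_def elim!: sign_cases)
  thus ?thesis using that(2) step by blast
qed

text \<open>Suppose that an edge in direction \<open>i\<close> at \<open>w\<close> is reached across the
  quadrilaterals in directions \<open>j\<close> and \<open>k\<close>. If \<open>j = k\<close>, uniqueness on this
  quadrilateral suffices. Otherwise both are faces of the cube in directions \<open>i, j, k\<close> whose
  corner \<open>y\<close> nearest to the origin lies two levels below \<open>w\<close>; all other
  reflections on these faces are obtained from the three edges at \<open>y\<close>, by induction, and the
  cube makes the two results agree.\<close>

lemma outward_unique:
  "outward x g w i s f \<Longrightarrow> outward x g w i s f' \<Longrightarrow> f = f'"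
proof (induction "level w" arbitrary: w i s f f' rule: less_induct)
  case less
  from less.prems(1) show ?case
  proof (cases rule: outward_inversion)
    case 1
    note on_axis = 1
    from less.prems(2) show ?thesis
    proof (cases rule: outward_inversion)
      case 1
      thus ?thesis using on_axis by simp
    next
      case (2 j)
      thus ?thesis using on_axis(1) unfolding coordinate_axis_iff by metis
    qed
  next
    case (2 j z t f1 f2 h2)
    note F = 2
    have s: "\<bar>s\<bar> = 1" and t: "\<bar>t\<bar> = 1" "0 \<le> t * z $ j"
      using outward_sign[OF F(5)] outward_sign[OF F(6)] by auto
    have lz: "level z < level w" unfolding F(2) level_step[OF t] by (rule lessI)
    from less.prems(2) show ?thesis
    proof (cases rule: outward_inversion)
      case 1
      thus ?thesis using F(1,3) by (auto simp: coordinate_axis_iff)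
    next
      case (2 k z' u f1' f2' h2')
      note G = 2
      have u: "\<bar>u\<bar> = 1" "0 \<le> u * z' $ k" using outward_sign[OF G(6)] by auto
      have lz': "level z' < level w" unfolding G(2) level_step[OF u] by (rule lessI)
      show ?thesis
      proof (cases "j = k")
        case True
        have "t = u" using F(4) G(4) True by simp
        moreover have "z = z'" using F(2) G(2) True \<open>t = u\<close> by (metis add_right_cancel)
        ultimately have G': "outward x g z i s f1'" "outward x g z j t f2'"
          "propagates (x z) (x (z + axis i s)) (x (z + axis i s + axis j t)) (x (z + axis j t)) f1' f2' f' h2'"
          using G(5-7) True by simp_all
        have "f1 = f1'" "f2 = f2'" using less.hyps[OF lz] F(5,6) G'(1,2) by blast+
        hence "propagates (x z) (x (z + axis i s)) (x (z + axis i s + axis j t)) (x (z + axis j t)) f1 f2 f' h2'"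
          using G'(3) by simp
        from propagates_unique[OF dim generic_Q_net_planar_quad[OF net F(1) s t(1)]
            outward_F_opi[OF F(5)] outward_F_opi[OF F(6)] outward_maps[OF F(5)] outward_maps[OF F(6)]
            F(7) this]
        show ?thesis by simp
      next
        case False
        define y where "y = z - axis k u"
        have z: "z = y + axis k u" by (simp add: y_def)
        have "z + axis j t = z' + axis k u" using F(2) G(2) by metis
        hence z': "z' = y + axis j t" by (simp add: y_def algebra_simps)
        have yk: "y $ k = z' $ k" and yj: "y $ j = z $ j" and yi: "y $ i = z $ i"
          using False F(1) G(1) by (simp_all add: z z' axis_def)
        obtain a where a: "outward x g y i s a"
          using outward_exists[OF s, of y i] outward_sign[OF F(5)] yi by auto
        obtain b where b: "outward x g y j t b" using outward_exists[OF t(1), of y j] t(2) yj by auto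
        obtain c where c: "outward x g y k u c" using outward_exists[OF u(1), of y k] u(2) yk by auto
        obtain ck ci where ki: "propagates (x y) (x (y + axis k u)) (x (y + axis k u + axis i s))
            (x (y + axis i s)) c a ck ci" "outward x g (y + axis k u) i s ci"
          using outward_quad[OF G(1)[symmetric] c a] by blast
        obtain bj bi where ji: "propagates (x y) (x (y + axis j t)) (x (y + axis j t + axis i s))
            (x (y + axis i s)) b a bj bi" "outward x g (y + axis j t) i s bi"
          using outward_quad[OF F(1)[symmetric] b a] by blast
        obtain ckj bjk where kj: "propagates (x y) (x (y + axis k u)) (x (y + axis k u + axis j t))
            (x (y + axis j t)) c b ckj bjk" "outward x g (y + axis j t) k u ckj"
            "outward x g (y + axis k u) j t bjk"
          using outward_quad[OF False[symmetric] c b] by blast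
        have f: "f1 = ci" "f2 = bjk" using less.hyps[OF lz] F(5,6) ki(2) kj(3) unfolding z by blast+
        have f': "f1' = bi" "f2' = ckj" using less.hyps[OF lz'] G(5,6) ji(2) kj(2) unfolding z' by blast+
        have p1: "propagates (x (y + axis k u)) (x (y + axis k u + axis j t))
            (x (y + axis k u + axis j t + axis i s)) (x (y + axis k u + axis i s)) bjk ci h2 f"
          using propagates_swap[OF F(7)] f by (simp add: z add_ac)
        have p2: "propagates (x (y + axis j t)) (x (y + axis j t + axis i s))
            (x (y + axis k u + axis j t + axis i s)) (x (y + axis k u + axis j t)) bi ckj f' h2'"
          using G(7) f' by (simp add: z' add_ac)
        note quad = generic_Q_net_planar_quad[OF net]
        have q1: "planar_quad (x (y + axis k u)) (x (y + axis k u + axis j t))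
            (x (y + axis k u + axis j t + axis i s)) (x (y + axis k u + axis i s))"
          using quad[OF F(1)[symmetric] t(1) s] .
        have q2: "planar_quad (x (y + axis j t)) (x (y + axis k u + axis j t))
            (x (y + axis k u + axis j t + axis i s)) (x (y + axis j t + axis i s))"
          using quad[OF G(1)[symmetric] u(1) s, of "y + axis j t"] by (simp add: add_ac)
        have q3: "planar_quad (x (y + axis i s)) (x (y + axis k u + axis i s))
            (x (y + axis k u + axis j t + axis i s)) (x (y + axis j t + axis i s))"
          using quad[OF False[symmetric] u(1) t(1), of "y + axis i s"] by (simp add: add_ac)
        have sp: "\<not> on_plane {x (y + axis j t + axis i s), x (y + axis j t), x (y + axis i s),
            x (y + axis k u + axis j t + axis i s)}"
        proof -
          let ?v = "y + axis j t + axis i s"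
          have "?v + axis j (-t) = y + axis i s" by (simp add: vec_eq_iff axis_def)
          moreover have "?v + axis k u = y + axis k u + axis j t + axis i s" by (simp add: add_ac)
          moreover have "?v + axis i (-s) = y + axis j t" by simp
          moreover have "\<not> on_plane {x ?v, x (?v + axis i (-s)), x (?v + axis j (-t)), x (?v + axis k u)}"
            by (rule generic_Q_net_spatial[OF dim2 net F(1) G(1) False _ _ u(1)]) (use s t in simp_all)
          ultimately show ?thesis by (simp only: not_False_eq_True)
        qed
        obtain h1 where "propagates (x (y + axis j t)) (x (y + axis k u + axis j t))
            (x (y + axis k u + axis j t + axis i s)) (x (y + axis j t + axis i s)) ckj bi h1 f"
          using cube_propagation[OF dim quad[OF False[symmetric] u(1) t(1)] quad[OF G(1)[symmetric] u(1) s]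
              quad[OF F(1)[symmetric] t(1) s] q1 q2 q3 sp outward_F_opi[OF c] outward_F_opi[OF b]
              outward_F_opi[OF a] outward_maps[OF c] outward_maps[OF b] outward_maps[OF a]
              kj(1) ki(1) ji(1) p1] by blast
        moreover have "propagates (x (y + axis j t)) (x (y + axis k u + axis j t))
            (x (y + axis k u + axis j t + axis i s)) (x (y + axis j t + axis i s)) ckj bi h2' f'"
          by (rule propagates_swap[OF p2])
        moreover have "ckj (x (y + axis j t)) = x (y + axis k u + axis j t)"
          using outward_maps[OF kj(2)] by (simp add: add_ac)
        ultimately show ?thesis
          using propagates_unique[OF dim q2 outward_F_opi[OF kj(2)] outward_F_opi[OF ji(2)]]
            outward_maps[OF ji(2)] by blast
      qed
    qed
  qed
qed

end

section \<open>Families of reflections on all edges\<close>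

text \<open>A family records each reflection at the lower end of its edge; here the edge in direction
  \<open>i\<close> is read off from either end, according to the sign \<open>s\<close>.\<close>

definition edge_value ::
  "('m \<Rightarrow> int ^ 'm::finite \<Rightarrow> 'a pspace \<Rightarrow> 'a pspace) \<Rightarrow>
   'm \<Rightarrow> int ^ 'm \<Rightarrow> int \<Rightarrow> 'a::euclidean_space pspace \<Rightarrow> 'a pspace" where
  "edge_value f i z s = f i (if s = 1 then z else z - unit_step i)"

lemma edge_value_reverse:
  "\<bar>s\<bar> = 1 \<Longrightarrow> edge_value f i (z + axis i s) (-s) = edge_value f i z s"
  by (elim sign_cases) (simp_all add: edge_value_def axis_minus_one)

lemma edge_value_maps:
  fixes x :: "int ^ 'm::finite \<Rightarrow> 'a::euclidean_space pspace"
  assumes d2: "DIM('a) \<ge> 2" and f: "\<And>z i. f i z \<in> F_opi \<and> f i z (x z) = x (z + unit_step i)"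
    and s: "\<bar>s\<bar> = 1"
  shows "edge_value f i z s \<in> F_opi" "edge_value f i z s (x z) = x (z + axis i s)"
proof -
  show "edge_value f i z s \<in> F_opi" using f by (simp add: edge_value_def)
  show "edge_value f i z s (x z) = x (z + axis i s)" using s
  proof (cases rule: sign_cases)
    case 1
    thus ?thesis using f by (simp add: edge_value_def)
  next
    case 2
    have "f i (z - unit_step i) (x (z - unit_step i)) = x z"
      using f[of i "z - unit_step i"] by simp
    thus ?thesis
      using F_opi_involution[OF d2, of "f i (z - unit_step i)" "x (z - unit_step i)"] f 2
      by (simp add: edge_value_def axis_minus_one)
  qed
qed

definition propagates_at ::
  "(int ^ 'm::finite \<Rightarrow> 'a::euclidean_space pspace) \<Rightarrow>
   ('m \<Rightarrow> int ^ 'm \<Rightarrow> 'a pspace \<Rightarrow> 'a pspace) \<Rightarrow> int ^ 'm \<Rightarrow> 'm \<Rightarrow> int \<Rightarrow> 'm \<Rightarrow> int \<Rightarrow> bool" where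
  "propagates_at x f z i s j t \<longleftrightarrow>
     propagates (x z) (x (z + axis i s)) (x (z + axis i s + axis j t)) (x (z + axis j t))
       (edge_value f i z s) (edge_value f j z t)
       (edge_value f i (z + axis j t) s) (edge_value f j (z + axis i s) t)"

lemma propagates_at_swap: "propagates_at x f z i s j t \<Longrightarrow> propagates_at x f z j t i s"
  unfolding propagates_at_def using propagates_swap by (force simp: add_ac)

lemma propagates_at_flip:
  fixes x :: "int ^ 'm::finite \<Rightarrow> 'a::euclidean_space pspace"
  assumes d2: "DIM('a) \<ge> 2" and f: "\<And>z i. f i z \<in> F_opi \<and> f i z (x z) = x (z + unit_step i)"
    and s: "\<bar>s\<bar> = 1" and t: "\<bar>t\<bar> = 1" and p: "propagates_at x f z i s j t"
  shows "propagates_at x f (z + axis i s) i (-s) j t"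
proof -
  have e: "z + axis i s + axis j t = z + axis j t + axis i s" by (simp add: add_ac)
  note v = edge_value_maps[OF d2 f]
  show ?thesis
    using propagates_flip[OF d2 v(1)[OF s] v(1)[OF t] v(2)[OF s] v(2)[OF t] p[unfolded propagates_at_def]]
    unfolding propagates_at_def axis_neg_cancel e edge_value_reverse[OF s] .
qed

lemma propagates_at_any_corner:
  fixes x :: "int ^ 'm::finite \<Rightarrow> 'a::euclidean_space pspace"
  assumes d2: "DIM('a) \<ge> 2" and f: "\<And>z i. f i z \<in> F_opi \<and> f i z (x z) = x (z + unit_step i)"
    and t: "\<bar>t\<bar> = 1" "\<bar>t'\<bar> = 1" and s: "\<bar>s\<bar> = 1" "\<bar>s'\<bar> = 1"
    and p: "\<And>z. propagates_at x f z i s j t"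
  shows "propagates_at x f z i s' j t'"
proof -
  have turn: "\<And>z. propagates_at x f z i s' j t"
    if p: "\<And>z. propagates_at x f z i s j t" and s: "\<bar>s\<bar> = 1" "\<bar>s'\<bar> = 1" and t: "\<bar>t\<bar> = 1"
    for i s j t s'
  proof -
    fix z
    have "s' = s \<or> s' = -s" using s by linarith
    thus "propagates_at x f z i s' j t"
      using propagates_at_flip[OF d2 f s(1) t p, of "z + axis i (-s)"] p by auto
  qed
  have 1: "propagates_at x f z i s' j t" for z by (rule turn[OF p s t(1)])
  have "propagates_at x f z j t' i s'"
    by (rule turn[OF propagates_at_swap[OF 1] t s(2)])
  thus ?thesis by (rule propagates_at_swap)
qed

lemma propagated_family_iff:
  "propagated_family x f \<longleftrightarrow>
    (\<forall>z i. f i z \<in> F_opi \<and> f i z (x z) = x (z + unit_step i)) \<and>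
    (\<forall>z i j. i \<noteq> j \<longrightarrow> propagates_at x f z i 1 j 1)"
  unfolding propagated_family_def propagates_at_def edge_value_def by simp

context
  fixes x :: "int ^ 'm::finite \<Rightarrow> 'a::euclidean_space pspace"
    and g :: "'m \<Rightarrow> int ^ 'm \<Rightarrow> 'a pspace \<Rightarrow> 'a pspace"
  assumes dim: "DIM('a) \<ge> 4" and net: "generic_Q_net x" and cauchy: "generic_cauchy_data x g"
begin

text \<open>A propagated family satisfies the propagation relation at all corners of all quadrilaterals, so
  it follows every step away from the origin; hence the Cauchy data determine it.\<close>

lemma outward_edge_value:
  assumes f: "propagated_family x f" "\<forall>i. \<forall>z\<in>coordinate_axis i. f i z = g i z"
  shows "outward x g z i s h \<Longrightarrow> h = edge_value f i z s"
proof (induction rule: outward.induct)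
  case (pos z i)
  thus ?case using f(2) by (simp add: edge_value_def)
next
  case (neg z i)
  thus ?case using f(2) coordinate_axis_pred[OF neg(1)] by (simp add: edge_value_def)
next
  case (step i j z s f1 t f2 h1 h2)
  have s: "\<bar>s\<bar> = 1" and t: "\<bar>t\<bar> = 1" using outward_sign step(2,3) by blast+
  have fe: "\<And>z i. f i z \<in> F_opi \<and> f i z (x z) = x (z + unit_step i)"
    and fp: "\<And>z. propagates_at x f z i 1 j 1"
    using f(1) step(1) unfolding propagated_family_iff by auto
  have d2: "DIM('a) \<ge> 2" using dim by simp
  have "propagates_at x f z i s j t"
    by (rule propagates_at_any_corner[OF d2 fe _ t _ s fp]) simp_all
  thus ?case
    using propagates_unique[OF dim generic_Q_net_planar_quad[OF net step(1) s t] _ _ _ _ step(4)]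
      edge_value_maps[OF d2 fe s, of i z] edge_value_maps[OF d2 fe t, of j z] step.IH
    unfolding propagates_at_def by blast
qed

text \<open>An edge leads away from the origin at exactly one of its ends; the sign of the coordinate
  in its direction tells which one.\<close>

definition outward_family :: "'m \<Rightarrow> int ^ 'm \<Rightarrow> 'a pspace \<Rightarrow> 'a pspace" where
  "outward_family i z =
     (if 0 \<le> z $ i then THE f. outward x g z i 1 f
      else THE f. outward x g (z + unit_step i) i (-1) f)"

lemma outward_family_value:
  assumes h: "outward x g z i s h"
  shows "edge_value outward_family i z s = h"
proof -
  have the: "(THE f. outward x g z i s f) = h"
    using h outward_unique[OF dim net cauchy] by blast
  have s: "\<bar>s\<bar> = 1" "0 \<le> s * z $ i" using outward_sign[OF h] by auto
  show ?thesis using s(1)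
  proof (cases rule: sign_cases)
    case 1
    thus ?thesis using the s by (simp add: edge_value_def outward_family_def)
  next
    case 2
    hence "\<not> 0 \<le> (z - unit_step i) $ i" using s by (simp add: axis_def)
    thus ?thesis using the 2 by (simp add: edge_value_def outward_family_def)
  qed
qed

lemma outward_family_cauchy:
  assumes "z \<in> coordinate_axis i"
  shows "outward_family i z = g i z"
proof (cases "0 \<le> z $ i")
  case True
  thus ?thesis using outward_family_value[OF outward.pos[OF assms]] by (simp add: edge_value_def)
next
  case False
  have "z + unit_step i \<in> coordinate_axis i" using assms by (simp add: coordinate_axis_iff axis_def)
  moreover have "(z + unit_step i) $ i \<le> 0" using False by (simp add: axis_def)
  ultimately show ?thesis
    using outward_family_value[OF outward.neg, of "z + unit_step i" i] by (simp add: edge_value_def)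
qed

text \<open>At the corner nearest to the origin each quadrilateral is filled by an outward step; the
  symmetries of the propagation relation carry this over to the corner with the lowest coordinates.\<close>

lemma outward_family_propagated: "propagated_family x outward_family"
proof -
  have d2: "DIM('a) \<ge> 2" using dim by simp
  have ex: "\<exists>f. outward x g z i s f" if "\<bar>s\<bar> = 1" "0 \<le> s * z $ i" for z i s
    by (rule outward_exists[OF dim net cauchy that])
  have maps: "outward_family i z \<in> F_opi \<and> outward_family i z (x z) = x (z + unit_step i)" for i z
  proof (cases "0 \<le> z $ i")
    case True
    then obtain h where h: "outward x g z i 1 h" using ex[of 1 z i] by auto
    thus ?thesis using outward_family_value[OF h] outward_F_opi[OF dim net cauchy h]
        outward_maps[OF dim net cauchy h] by (simp add: edge_value_def)
  next
    case False
    hence "0 \<le> (-1) * (z + unit_step i) $ i" by (simp add: axis_def)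
    then obtain h where h: "outward x g (z + unit_step i) i (-1) h" using ex[of "-1" "z + unit_step i" i] by auto
    have "h \<in> F_opi" "h (x (z + unit_step i)) = x z"
      using outward_F_opi[OF dim net cauchy h] outward_maps[OF dim net cauchy h] by auto
    thus ?thesis using outward_family_value[OF h] F_opi_involution[OF d2, of h "x (z + unit_step i)"]
      by (simp add: edge_value_def)
  qed
  have out: "propagates_at x outward_family z i s j t"
    if ij: "i \<noteq> j" and s: "\<bar>s\<bar> = 1" "0 \<le> s * z $ i" and t: "\<bar>t\<bar> = 1" "0 \<le> t * z $ j" for z i s j t
  proof -
    obtain f1 where f1: "outward x g z i s f1" using ex[OF s] by blast
    obtain f2 where f2: "outward x g z j t f2" using ex[OF t] by blast
    obtain h1 h2 where h:
      "propagates (x z) (x (z + axis i s)) (x (z + axis i s + axis j t)) (x (z + axis j t)) f1 f2 h1 h2"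
      and h1: "outward x g (z + axis j t) i s h1" and h2: "outward x g (z + axis i s) j t h2"
      using outward_quad[OF dim net cauchy ij f1 f2] by blast
    show ?thesis unfolding propagates_at_def
      using h by (simp only: outward_family_value[OF f1] outward_family_value[OF f2]
          outward_family_value[OF h1] outward_family_value[OF h2])
  qed
  \<comment> \<open>First flip direction \<open>i\<close> where it points towards the origin, then direction \<open>j\<close>.\<close>
  have half: "propagates_at x outward_family z i 1 j t"
    if ij: "i \<noteq> j" and t: "\<bar>t\<bar> = 1" "0 \<le> t * z $ j" for z i j t
  proof (cases "0 \<le> z $ i")
    case True
    thus ?thesis using out[OF ij _ _ t, of 1] by simp
  next
    case False
    hence "propagates_at x outward_family (z + unit_step i) i (-1) j t"
      using ij t by (intro out) (auto simp: axis_def)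
    from propagates_at_flip[OF d2 maps _ t(1) this] show ?thesis by simp
  qed
  have "propagates_at x outward_family z i 1 j 1" if ij: "i \<noteq> j" for z i j
  proof (cases "0 \<le> z $ j")
    case True
    thus ?thesis using half[OF ij, of 1] by simp
  next
    case False
    hence "propagates_at x outward_family (z + unit_step j) i 1 j (-1)"
      using ij by (intro half) (auto simp: axis_def)
    from propagates_at_flip[OF d2 maps _ _ propagates_at_swap[OF this]]
    have "propagates_at x outward_family z j 1 i 1" by simp
    thus ?thesis by (rule propagates_at_swap)
  qed
  thus ?thesis unfolding propagated_family_iff
    by (intro conjI allI impI maps[THEN conjunct1] maps[THEN conjunct2])
qed

lemma propagated_family_eq_outward_family:
  assumes f: "propagated_family x f" "\<forall>i. \<forall>z\<in>coordinate_axis i. f i z = g i z"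
  shows "f = outward_family"
proof (intro ext)
  fix i z p
  have "f i z = outward_family i z"
  proof (cases "0 \<le> z $ i")
    case True
    then obtain h where h: "outward x g z i 1 h" using outward_exists[OF dim net cauchy, of 1 z i] by auto
    thus ?thesis using outward_edge_value[OF f h] outward_family_value[OF h] by (simp add: edge_value_def)
  next
    case False
    hence "0 \<le> (-1) * (z + unit_step i) $ i" by (simp add: axis_def)
    then obtain h where h: "outward x g (z + unit_step i) i (-1) h"
      using outward_exists[OF dim net cauchy, of "-1" "z + unit_step i" i] by auto
    thus ?thesis using outward_edge_value[OF f h] outward_family_value[OF h] by (simp add: edge_value_def)
  qed
  thus "f i z p = outward_family i z p" by simp
qed

end

lemma generic_Q_net_mD_consistent:
  fixes x :: "int ^ 'm::finite \<Rightarrow> 'a::euclidean_space pspace"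
  assumes "DIM('a) \<ge> 4" "generic_Q_net x"
  shows "mD_consistent x"
  unfolding mD_consistent_def
proof (intro allI impI)
  fix g assume g: "generic_cauchy_data x g"
  show "\<exists>!f. propagated_family x f \<and> (\<forall>i. \<forall>z\<in>coordinate_axis i. f i z = g i z)"
  proof (rule ex1I)
    show "propagated_family x (outward_family x g) \<and>
        (\<forall>i. \<forall>z\<in>coordinate_axis i. outward_family x g i z = g i z)"
      by (intro conjI allI ballI outward_family_propagated[OF assms g] outward_family_cauchy[OF assms g])
  next
    fix f assume "propagated_family x f \<and> (\<forall>i. \<forall>z\<in>coordinate_axis i. f i z = g i z)"
    thus "f = outward_family x g"
      by (elim conjE) (rule propagated_family_eq_outward_family[OF assms g])
  qed
qed

theorem theorem43:
  fixes N :: nat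
  assumes "N \<ge> 3" and "DIM('a::euclidean_space) = N + 1"
  shows "(\<forall>(x :: 'a pspace) x1 x12 x2 f1 f2.
            on_plane {x, x1, x12, x2} \<and> nondegenerate_quad x x1 x12 x2 \<and>
            f1 \<in> F_opi \<and> f2 \<in> F_opi \<and> f1 x = x1 \<and> f2 x = x2 \<and>
            generic_reflections x x12 f1 f2
            \<longrightarrow> (\<exists>!h. propagates x x1 x12 x2 f1 f2 (fst h) (snd h)))
       \<and> (\<forall>x :: int ^ 'm::finite \<Rightarrow> 'a pspace. generic_Q_net x \<longrightarrow> mD_consistent x)"
proof (intro conjI allI impI)
  have dim: "DIM('a) \<ge> 4" using assms by simp
  fix x x1 x12 x2 :: "'a pspace" and f1 f2
  assume a: "on_plane {x, x1, x12, x2} \<and> nondegenerate_quad x x1 x12 x2 \<and>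
            f1 \<in> F_opi \<and> f2 \<in> F_opi \<and> f1 x = x1 \<and> f2 x = x2 \<and>
            generic_reflections x x12 f1 f2"
  hence q: "planar_quad x x1 x12 x2" by (simp add: planar_quad_def)
  obtain h1 h2 where h: "propagates x x1 x12 x2 f1 f2 h1 h2"
    using a by (elim conjE) (use propagates_exists[OF dim q] in blast)
  show "\<exists>!h. propagates x x1 x12 x2 f1 f2 (fst h) (snd h)"
  proof (rule ex1I[of _ "(h1, h2)"])
    fix k assume "propagates x x1 x12 x2 f1 f2 (fst k) (snd k)"
    hence "fst k = h1 \<and> snd k = h2" using a h by (elim conjE) (rule propagates_unique[OF dim q])
    thus "k = (h1, h2)" by (simp add: prod_eq_iff)
  qed (use h in simp)
next
  fix x :: "int ^ 'm \<Rightarrow> 'a pspace"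
  assume "generic_Q_net x"
  thus "mD_consistent x"
    by (rule generic_Q_net_mD_consistent[rotated]) (use assms in simp)
qed

end
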